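(* Let $L>0$, $a,b,c>0$, and let $p\in L^1[0,L]$ be nonnegative. Assume there is a constant $\lambda>0$ such that $$p(x)\le\Big[\lambda\frac{\pi^4}{L^4}+a\lambda\frac{\pi^2}{L^2}+2b\lambda^2\frac{\pi}{L}\Big]\sin\Big(\frac{\pi}{L}x\Big)+2\lambda c\frac{L}{\pi}\quad\text{for a.e. }x\in(0,L),$$ and $$c+b\lambda\frac{\pi^2}{L^2}\le\frac{4\big(a+2b\lambda\frac{L}{\pi}\big)}{L^3}\,\sigma\Big(\sqrt{a+2b\lambda\tfrac{L}{\pi}}\;L\Big).$$ Then $\alpha\equiv0$ is a lower solution and $\beta(x)=\lambda\sin(\frac{\pi}{L}x)$ is an upper solution of (P). Moreover, with $M=a+2b\lambda\frac{L}{\pi}$ and $N=c+b\lambda\frac{\pi^2}{L^2}$, the iterative sequences $(\alpha_n)$, $(\beta_n)$ generated by the iteration below from $y_0\equiv0$ and $y_0=\lambda\sin(\frac{\pi}{L}x)$ respectively converge uniformly to the minimal solution $\underline y$ and the maximal solution $\overline y$ of (P) in $\{u\in C^2[0,L]:0\le u\le\beta,\ 0\ge u''\ge\beta''\}$.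
   Context: (P) is the problem $w''''(x)-(a+b\int_0^L w(t)dt)w''(x)+c\int_0^L w(t)dt=p(x)$ a.e. in $(0,L)$, $w(0)=w(L)=w''(0)=w''(L)=0$, with solutions in $W^{4,1}[0,L]$. $\sigma(t):=\dfrac{3t^3}{6t\cosh t+6t-12\sinh t-t^3}$ for $t>0$. A lower solution of (P) is $\alpha\in W^{4,1}[0,L]$ with $\alpha''''-(a+b\int_0^L\alpha)\alpha''+c\int_0^L\alpha\le p$ a.e. and $\alpha(0)=\alpha(L)=\alpha''(0)=\alpha''(L)=0$; an upper solution has the reversed inequality. The iteration: $y_n\in W^{4,1}[0,L]$ is the unique solution of $$y_n''''-My_n''+N\int_0^L y_n\,dt=p(x)+b\,y_{n-1}''\int_0^L y_{n-1}\,dt-2b\lambda\frac{L}{\pi}y_{n-1}''+b\lambda\frac{\pi^2}{L^2}\int_0^L y_{n-1}\,dt,$$ $y_n(0)=y_n(L)=y_n''(0)=y_n''(L)=0$, $n\ge1$, with $M=a+2b\lambda L/\pi$, $N=c+b\lambda\pi^2/L^2$. *)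

theory Defs
  imports "HOL-Analysis.Analysis"
begin

definition sigma_fn :: "real \<Rightarrow> real" where
  "sigma_fn t = 3 * t ^ 3 / (6 * t * cosh t + 6 * t - 12 * sinh t - t ^ 3)"

text \<open>w belongs to W^{4,1}[0,L], with classical derivatives w1, w2, w3 on [0,L]
  (derivatives within the closed interval), w3 absolutely continuous with
  w3(x) = w3(0) + integral_0^x w4, w4 in L^1[0,L] (so w4 = w'''' a.e.).\<close>
definition W41 :: "real \<Rightarrow> (real \<Rightarrow> real) \<Rightarrow> (real \<Rightarrow> real) \<Rightarrow> (real \<Rightarrow> real)
    \<Rightarrow> (real \<Rightarrow> real) \<Rightarrow> (real \<Rightarrow> real) \<Rightarrow> bool" where
  "W41 L w w1 w2 w3 w4 \<longleftrightarrow>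
     (\<forall>x\<in>{0..L}. (w has_real_derivative w1 x) (at x within {0..L}) \<and>
                 (w1 has_real_derivative w2 x) (at x within {0..L}) \<and>
                 (w2 has_real_derivative w3 x) (at x within {0..L})) \<and>
     w4 absolutely_integrable_on {0..L} \<and>
     (\<forall>x\<in>{0..L}. w3 x = w3 0 + integral {0..x} w4)"

definition BC :: "real \<Rightarrow> (real \<Rightarrow> real) \<Rightarrow> (real \<Rightarrow> real) \<Rightarrow> bool" where
  "BC L w w2 \<longleftrightarrow> w 0 = 0 \<and> w L = 0 \<and> w2 0 = 0 \<and> w2 L = 0"

definition P_lhs :: "real \<Rightarrow> real \<Rightarrow> real \<Rightarrow> real \<Rightarrow> (real \<Rightarrow> real) \<Rightarrow> (real \<Rightarrow> real)
    \<Rightarrow> (real \<Rightarrow> real) \<Rightarrow> real \<Rightarrow> real" where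
  "P_lhs L a b c w w2 w4 x =
     w4 x - (a + b * integral {0..L} w) * w2 x + c * integral {0..L} w"

definition is_solution :: "real \<Rightarrow> real \<Rightarrow> real \<Rightarrow> real \<Rightarrow> (real \<Rightarrow> real) \<Rightarrow> (real \<Rightarrow> real) \<Rightarrow> bool" where
  "is_solution L a b c p w \<longleftrightarrow> (\<exists>w1 w2 w3 w4. W41 L w w1 w2 w3 w4 \<and> BC L w w2 \<and>
     (AE x in lborel. x \<in> {0<..<L} \<longrightarrow> P_lhs L a b c w w2 w4 x = p x))"

definition is_lower_solution :: "real \<Rightarrow> real \<Rightarrow> real \<Rightarrow> real \<Rightarrow> (real \<Rightarrow> real) \<Rightarrow> (real \<Rightarrow> real) \<Rightarrow> bool" where
  "is_lower_solution L a b c p w \<longleftrightarrow> (\<exists>w1 w2 w3 w4. W41 L w w1 w2 w3 w4 \<and> BC L w w2 \<and>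
     (AE x in lborel. x \<in> {0<..<L} \<longrightarrow> P_lhs L a b c w w2 w4 x \<le> p x))"

definition is_upper_solution :: "real \<Rightarrow> real \<Rightarrow> real \<Rightarrow> real \<Rightarrow> (real \<Rightarrow> real) \<Rightarrow> (real \<Rightarrow> real) \<Rightarrow> bool" where
  "is_upper_solution L a b c p w \<longleftrightarrow> (\<exists>w1 w2 w3 w4. W41 L w w1 w2 w3 w4 \<and> BC L w w2 \<and>
     (AE x in lborel. x \<in> {0<..<L} \<longrightarrow> P_lhs L a b c w w2 w4 x \<ge> p x))"

definition iter_step :: "real \<Rightarrow> real \<Rightarrow> real \<Rightarrow> real \<Rightarrow> real \<Rightarrow> (real \<Rightarrow> real)
    \<Rightarrow> (real \<Rightarrow> real) \<Rightarrow> (real \<Rightarrow> real) \<Rightarrow> bool" where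
  "iter_step L a b c lam p z y \<longleftrightarrow>
     (let M = a + 2 * b * lam * L / pi; N = c + b * lam * pi ^ 2 / L ^ 2 in
      \<exists>y1 y2 y3 y4 z1 z2 z3 z4. W41 L y y1 y2 y3 y4 \<and> BC L y y2 \<and> W41 L z z1 z2 z3 z4 \<and>
        (AE x in lborel. x \<in> {0<..<L} \<longrightarrow>
           y4 x - M * y2 x + N * integral {0..L} y =
           p x + b * z2 x * integral {0..L} z - 2 * b * lam * (L / pi) * z2 x
               + b * lam * (pi ^ 2 / L ^ 2) * integral {0..L} z))"

definition in_S :: "real \<Rightarrow> real \<Rightarrow> (real \<Rightarrow> real) \<Rightarrow> bool" where
  "in_S L lam u \<longleftrightarrow> (\<exists>u1 u2.
     (\<forall>x\<in>{0..L}. (u has_real_derivative u1 x) (at x within {0..L}) \<and>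
                 (u1 has_real_derivative u2 x) (at x within {0..L})) \<and>
     continuous_on {0..L} u2 \<and>
     (\<forall>x\<in>{0..L}. 0 \<le> u x \<and> u x \<le> lam * sin (pi / L * x) \<and>
                 u2 x \<le> 0 \<and> - lam * (pi / L) ^ 2 * sin (pi / L * x) \<le> u2 x))"

end

theory Submission
  imports Defs
begin

text \<open>
  In terms of $v = -y''$ the linear fourth order problem of the iteration is
  $-v'' + M v + N \int_0^L \frac{s(L-s)}{2} v(s)\,ds = f$, $v(0) = v(L) = 0$. The bound on $N$ is exactly
  what makes the Green function of this nonlocal problem nonnegative, so $f \ge 0$ implies
  $v \ge 0$, and hence $y \ge 0$. With the chosen $M$ and $N$ the right-hand side of the iteration
  is increasing in $v$ on $0 \le v \le -\beta''$, so the iterates started at $0$ and at $\beta$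
  are monotone in $v$ and squeeze every solution between them; their limits are fixed points.
\<close>

text \<open>Two obstacles shape the argument. The datum is only in L^1, so v'' exists only almost
  everywhere. The equation is therefore kept in terms of a primitive F of the datum: v' + F is
  classically differentiable, and a nonnegative datum becomes a monotone F. Secondly, the nonlocal
  term is a rank-one perturbation of -v'' + M v, so its Green function is G(x,s) - N e(x) psi(s) /
  (1 + N kappa), with e and psi the responses to the data 1 and s(L-s)/2. Both G and the product e
  psi vanish at the boundary, and their ratio is worst when x and s tend to opposite ends of the
  interval. Comparing slopes there gives the constant with \<open>sigma_fn\<close>. Finally,
  monotone iterates are only known to converge pointwise. Regularity of the limit has to come from
  the equation, and uniform convergence from the smoothing map v -> y.\<close>

section \<open>Elementary hyperbolic inequalities\<close>

lemma le_sinh: "u \<le> sinh u" if "0 \<le> u" for u :: real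
  using real_le_x_sinh[OF that] by (simp add: sinh_field_def exp_minus)

lemma sinh_less_mult_cosh: "sinh u < u * cosh u" if "0 < u" for u :: real
proof -
  have "(\<lambda>u. u * cosh u - sinh u) 0 < (\<lambda>u::real. u * cosh u - sinh u) u"
    by (rule DERIV_pos_imp_increasing_open[OF that])
       (auto intro!: derivative_eq_intros continuous_intros exI)
  then show ?thesis by simp
qed

text \<open>In half-angle form this is tanh(u/2) < u/2, which is how it yields \<open>p1_pos\<close>
  later.\<close>

lemma cosh_less_sinh_bound: "cosh u < 1 + u * sinh u / 2" if "0 < u" for u :: real
proof -
  have "(\<lambda>u. u * sinh u / 2 + 1 - cosh u) 0 < (\<lambda>u::real. u * sinh u / 2 + 1 - cosh u) u"
  proof (rule DERIV_pos_imp_increasing_open[OF that])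
    fix x :: real
    assume "0 < x"
    then show "\<exists>y. ((\<lambda>u. u * sinh u / 2 + 1 - cosh u) has_real_derivative y) (at x) \<and> y > 0"
      using sinh_less_mult_cosh[of x]
      by (intro exI[of _ "(x * cosh x - sinh x) / 2"])
         (auto intro!: derivative_eq_intros simp: field_simps)
  qed (auto intro!: continuous_intros)
  then show ?thesis by simp
qed

text \<open>The part of the difference without cosh is (t - u)(sinh u - u)/2 + u sinh u / 2, so two
  one-variable inequalities suffice. With u = m s and t = m L this is the bound of
  \<open>psi\<close> by its tangent multiple of sinh.\<close>

lemma cosh_sinh_parabola_bound:
  fixes u t :: real
  assumes "0 \<le> u" "u \<le> t"
  shows "u * (t - u) / 2 + cosh u - 1 \<le> t * sinh u / 2"
proof -
  have "0 \<le> (t - u) * (sinh u - u)"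
    using assms le_sinh[of u] by simp
  moreover have "cosh u \<le> 1 + u * sinh u / 2"
    using assms cosh_less_sinh_bound[of u] by (cases "u = 0") auto
  ultimately show ?thesis by (simp add: field_simps)
qed

lemma sinh_superadd: "sinh u + sinh w \<le> sinh (u + w)" if "0 \<le> u" "0 \<le> w" for u w :: real
proof -
  have "sinh u * 1 + 1 * sinh w \<le> sinh u * cosh w + cosh u * sinh w"
    using that by (intro add_mono mult_mono) (auto simp: cosh_real_ge_1)
  then show ?thesis by (simp add: sinh_add)
qed

section \<open>Testing the equation against a smooth function when only a primitive of the datum is
  available\<close>

lemma has_integral_real_derivative:
  fixes f :: "real \<Rightarrow> real"
  assumes "a \<le> b" "\<And>x. x \<in> {a..b} \<Longrightarrow> (f has_real_derivative f' x) (at x within {a..b})"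
  shows "(f' has_integral (f b - f a)) {a..b}"
  using assms by (intro fundamental_theorem_of_calculus)
    (auto simp flip: has_real_derivative_iff_has_vector_derivative)

text \<open>Partial integration for the measure $dF \ge 0$; it lets the $L^1$ data enter only through a
  primitive \<^term>\<open>F\<close>.\<close>

lemma integral_mono_mult_deriv_le:
  fixes F R R' :: "real \<Rightarrow> real"
  assumes "u \<le> w"
    and der: "\<And>x. x \<in> {u..w} \<Longrightarrow> (R has_real_derivative R' x) (at x within {u..w})"
    and mono: "mono_on {u..w} F"
    and nonneg: "\<And>x. x \<in> {u..w} \<Longrightarrow> 0 \<le> R x"
  shows "integral {u..w} (\<lambda>x. F x * R' x) \<le> F w * R w - F u * R u"
proof -
  have int: "(R' has_integral (R d - R c)) {c..d}" if "u \<le> c" "c \<le> d" "d \<le> w" for c d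
    using that by (intro has_integral_real_derivative) (auto intro!: DERIV_subset[OF der])
  \<comment> \<open>The second mean value theorem asks only monotonicity of F. It leaves the
    boundary terms minus R(c)(F(w) - F(u)), and the last product has a sign.\<close>
  obtain c where c: "c \<in> {u..w}"
    and eq: "integral {u..w} (\<lambda>x. F x * R' x)
      = F u * integral {u..c} R' + F w * integral {c..w} R'"
    by (rule second_mean_value_theorem[of R' u w F])
       (use int[of u w] \<open>u \<le> w\<close> mono in \<open>auto simp: mono_on_def\<close>)
  have ints: "integral {u..c} R' = R c - R u" "integral {c..w} R' = R w - R c"
    using int c by (auto intro!: integral_unique)
  have "0 \<le> R c * (F w - F u)"
    using nonneg[OF c] mono \<open>u \<le> w\<close> by (auto simp: mono_on_def)
  then show ?thesis
    unfolding eq ints by (simp add: algebra_simps)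
qed

definition moment :: "real \<Rightarrow> (real \<Rightarrow> real) \<Rightarrow> real" where
  "moment L v = integral {0..L} (\<lambda>s. s * (L - s) / 2 * v s)"

text \<open>The problem $-v'' + M v + N \int_0^L \frac{s(L-s)}{2} v(s)\,ds = f$, $v(0) = v(L) = 0$, for
  a primitive \<^term>\<open>F\<close> of the $L^1$ datum $f$; it is the fourth order linear problem with
  $v = -y''$, whose nonlocal term $\int_0^L y$ becomes \<^term>\<open>moment L v\<close>.\<close>

definition lin_sol :: "real \<Rightarrow> real \<Rightarrow> real \<Rightarrow> (real \<Rightarrow> real) \<Rightarrow> (real \<Rightarrow> real) \<Rightarrow> bool" where
  "lin_sol L M N F v \<longleftrightarrow> v 0 = 0 \<and> v L = 0 \<and>
     (\<exists>v1. \<forall>x\<in>{0..L}. (v has_real_derivative v1 x) (at x within {0..L}) \<and>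
        ((\<lambda>x. v1 x + F x) has_real_derivative M * v x + N * moment L v) (at x within {0..L}))"

lemma lin_sol_continuous: "lin_sol L M N F v \<Longrightarrow> continuous_on {0..L} v"
  unfolding lin_sol_def by (blast intro: DERIV_continuous_on)

text \<open>A Green identity for v and R. In \<open>G\<close> the bracket multiplied by N I / M,
  with I the moment of v, has derivative M R and so absorbs the nonlocal term, while the last
  integral absorbs the source d s(L-s)/2 of R. Replacing v1 by v1 + F gives an expression with
  derivative F R1, to which the monotone integration by parts applies. It is stated on a subinterval
  because the test function used later has a kink.\<close>

lemma lin_sol_test_piece:
  fixes R R1 :: "real \<Rightarrow> real"
  assumes v: "\<And>x. x \<in> {0..L} \<Longrightarrow> (v has_real_derivative v1 x) (at x within {0..L})"
    and H: "\<And>x. x \<in> {0..L} \<Longrightarrow>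
        ((\<lambda>x. v1 x + F x) has_real_derivative M * v x + N * moment L v) (at x within {0..L})"
    and "M \<noteq> 0" and uw: "0 \<le> u" "u \<le> w" "w \<le> L"
    and R: "\<And>x. x \<in> {u..w} \<Longrightarrow> (R has_real_derivative R1 x) (at x within {u..w})"
    and R1: "\<And>x. x \<in> {u..w} \<Longrightarrow>
        (R1 has_real_derivative M * R x + d * (x * (L - x) / 2)) (at x within {u..w})"
    and nonneg: "\<And>x. x \<in> {u..w} \<Longrightarrow> 0 \<le> R x"
    and mono: "mono_on {0..L} F"
    and G: "\<And>s. G s = R s * v1 s - R1 s * v s
        - N * moment L v / M * (R1 s - d * (L * s ^ 2 / 4 - s ^ 3 / 6))
        + d * integral {0..s} (\<lambda>s. s * (L - s) / 2 * v s)"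
  shows "G w - G u \<le> 0"
proof -
  let ?I = "moment L v"
  define q where "q s = v1 s + F s" for s
  define D where "D s = R s * q s - R1 s * v s
        - N * ?I / M * (R1 s - d * (L * s ^ 2 / 4 - s ^ 3 / 6))
        + d * integral {0..s} (\<lambda>s. s * (L - s) / 2 * v s)" for s
  have sub: "{u..w} \<subseteq> {0..L}" using uw by auto
  have cont: "continuous_on {0..L} (\<lambda>s. s * (L - s) / 2 * v s)"
    by (intro continuous_intros DERIV_continuous_on[OF v]) auto
  have "(D has_real_derivative F x * R1 x) (at x within {u..w})" if x: "x \<in> {u..w}" for x
  proof -
    have x0: "x \<in> {0..L}" using x sub by auto
    note d1 = DERIV_subset[OF v[OF x0] sub] and d2 = DERIV_subset[OF H[OF x0, folded q_def] sub]
    have d3: "((\<lambda>s. integral {0..s} (\<lambda>s. s * (L - s) / 2 * v s)) has_real_derivative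
        x * (L - x) / 2 * v x) (at x within {u..w})"
      by (rule DERIV_subset[OF integral_has_real_derivative[OF cont x0] sub])
    have d4: "((\<lambda>s. L * s ^ 2 / 4 - s ^ 3 / 6) has_real_derivative x * (L - x) / 2)
        (at x within {u..w})"
      by (auto intro!: derivative_eq_intros simp: field_simps power2_eq_square)
    show ?thesis
      unfolding D_def
      apply (rule DERIV_cong)
       apply (rule R[OF x] R1[OF x] d1 d2 d3 d4 DERIV_add DERIV_diff DERIV_cmult DERIV_mult)+
      using \<open>M \<noteq> 0\<close> by (simp add: q_def field_simps power2_eq_square)
  qed
  then have "((\<lambda>x. F x * R1 x) has_integral (D w - D u)) {u..w}"
    using uw by (intro has_integral_real_derivative) auto
  then have "D w - D u \<le> F w * R w - F u * R u"
    using integral_mono_mult_deriv_le[OF \<open>u \<le> w\<close> R mono_on_subset[OF mono sub] nonneg]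
    by (simp add: integral_unique)
  then show ?thesis by (simp add: D_def q_def G algebra_simps)
qed

section \<open>Maximum principle for the nonlocal problem\<close>

locale nonlocal_plate =
  fixes L M N m :: real
  assumes L: "0 < L" and m_pos: "0 < m" and m_square: "m\<^sup>2 = M" and N: "0 < N"
    and N_le: "N \<le> 4 * M / L ^ 3 * sigma_fn (m * L)"
begin

definition torsion where "torsion s = (1 - (sinh (m * s) + sinh (m * (L - s))) / sinh (m * L)) / M"
definition torsion1 where "torsion1 s = - (cosh (m * s) - cosh (m * (L - s))) / (m * sinh (m * L))"
text \<open>Since the parabola P = s(L-s)/2 has -P'' = 1, the operator -u'' + M u sends P to 1 + M
  P. Subtracting \<open>torsion\<close>, which is sent to 1, and dividing by M leaves a function
  sent to P.\<close>

definition psi where "psi s = (s * (L - s) / 2 - torsion s) / M"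
definition psi1 where "psi1 s = (L / 2 - s - torsion1 s) / M"
text \<open>\<open>T\<close> is tanh(mL/2) and \<open>p1\<close> is the slope of \<open>psi\<close>
  at 0. \<open>kappa\<close> is the integral of \<open>psi\<close>, found by integrating its
  equation over [0,L], where the parabola contributes L^3/12 and the end slopes 2
  \<open>p1\<close>.\<close>

definition T where "T = (cosh (m * L) - 1) / sinh (m * L)"
definition p1 where "p1 = (L / 2 - T / m) / M"
definition kappa where "kappa = (L ^ 3 / 12 - 2 * p1) / M"

lemma m: "0 < m" "m * m = M"
  using m_pos m_square by (auto simp: power2_eq_square)

lemma M: "0 < M"
  using m by auto

lemma sinh_mL: "0 < sinh (m * L)"
  using m L by simp

lemma torsion_deriv: "(torsion has_real_derivative torsion1 s) (at s within A)"
proof -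
  have eq: "torsion1 s = (- (cosh (m * s) * m - cosh (m * (L - s)) * m) / sinh (m * L)) / M"
    using m(1) L by (auto simp: torsion1_def field_simps simp flip: m(2))
  show ?thesis unfolding torsion_def[abs_def] eq
    using M L m(1) by (auto intro!: derivative_eq_intros simp: divide_simps)
qed

lemma torsion1_deriv: "(torsion1 has_real_derivative M * torsion s - 1) (at s within A)"
proof -
  have eq: "M * torsion s - 1 = (- (sinh (m * s) * m + sinh (m * (L - s)) * m) / (m * sinh (m * L)))"
    using m(1) L M by (simp add: torsion_def field_simps)
  show ?thesis unfolding torsion1_def[abs_def] eq
    using m sinh_mL by (auto intro!: derivative_eq_intros)
qed

lemma psi_deriv: "(psi has_real_derivative psi1 s) (at s within A)"
  unfolding psi_def[abs_def] psi1_def using M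
  by (auto intro!: derivative_eq_intros torsion_deriv simp: field_simps)

lemma psi1_deriv: "(psi1 has_real_derivative M * psi s - s * (L - s) / 2) (at s within A)"
  unfolding psi1_def[abs_def] psi_def using M
  by (auto intro!: derivative_eq_intros torsion1_deriv simp: field_simps)

lemma torsion_reflect: "torsion (L - s) = torsion s"
  by (simp add: torsion_def add.commute)

lemma psi_reflect: "psi (L - s) = psi s"
  by (simp add: psi_def torsion_reflect mult.commute)

lemma torsion_0_L [simp]: "torsion 0 = 0" "torsion L = 0"
  using sinh_mL by (auto simp: torsion_def)

lemma psi_0_L [simp]: "psi 0 = 0" "psi L = 0"
  by (auto simp: psi_def)

lemma torsion_eq: "torsion s = (1 - cosh (m * s) + T * sinh (m * s)) / M"
proof -
  have "sinh (m * (L - s)) = sinh (m * L) * cosh (m * s) - cosh (m * L) * sinh (m * s)"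
    by (simp add: right_diff_distrib sinh_diff)
  then show ?thesis
    using m(1) L by (simp add: torsion_def T_def field_simps)
qed

lemma torsion_nonneg: "0 \<le> torsion s" if "s \<in> {0..L}"
proof -
  have "sinh (m * s) + sinh (m * (L - s)) \<le> sinh (m * L)"
    using that m sinh_superadd[of "m * s" "m * (L - s)"] by (simp add: algebra_simps)
  then show ?thesis using sinh_mL M by (simp add: torsion_def)
qed

lemma torsion_le: "torsion s \<le> T * sinh (m * s) / M"
  unfolding torsion_eq using M by (intro divide_right_mono) (auto simp: cosh_real_ge_1)

text \<open>The multiple of sinh is the one with the slope of \<open>psi\<close> at 0. Like
  \<open>torsion_le\<close>, the bound is exact to first order at the boundary, so no constant is
  lost in the critical corner.\<close>

lemma psi_le: "psi s \<le> p1 * sinh (m * s) / m" if "s \<in> {0..L}"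
proof -
  have "m * s * (m * L - m * s) / 2 + cosh (m * s) - 1 \<le> m * L * sinh (m * s) / 2"
    using that m by (intro cosh_sinh_parabola_bound) auto
  then have "(m * s * (m * L - m * s) / 2 + cosh (m * s) - 1) / (M * M)
      \<le> (m * L * sinh (m * s) / 2) / (M * M)"
    using M by (intro divide_right_mono) auto
  moreover have "(m * s * (m * L - m * s) / 2 + cosh (m * s) - 1) / (M * M)
      = psi s + T * sinh (m * s) / (M * M)"
    unfolding psi_def torsion_eq using m(1) by (simp add: field_simps flip: m(2))
  moreover have "(m * L * sinh (m * s) / 2) / (M * M) - T * sinh (m * s) / (M * M)
      = p1 * sinh (m * s) / m"
    unfolding p1_def using m(1) by (simp add: field_simps flip: m(2))
  ultimately show ?thesis by linarith
qed

lemma T_pos: "0 < T"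
proof -
  have "1 < cosh (m * L)"
    using cosh_real_strict_mono[of 0 "m * L"] m L by simp
  then show ?thesis using sinh_mL by (simp add: T_def)
qed

lemma p1_pos: "0 < p1"
proof -
  have "T < m * L / 2"
    using cosh_less_sinh_bound[of "m * L"] m L sinh_mL by (simp add: T_def field_simps)
  then show ?thesis using m M by (simp add: p1_def field_simps)
qed

lemma torsion1_ends: "torsion1 0 = T / m" "torsion1 L = - T / m"
  using L m(1) by (auto simp: torsion1_def T_def divide_simps)

lemma psi1_ends: "psi1 0 = p1" "psi1 L = - p1"
  using M by (auto simp: psi1_def p1_def torsion1_ends field_simps)

text \<open>This is the bound on N in the form in which it is used: T sinh(mL) p1 / M - kappa equals
  L D / (12 M^2 t), where t = mL and D is the denominator of \<open>sigma_fn t\<close>.\<close>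

lemma kappa_bound: "N * T * sinh (m * L) * p1 / M \<le> 1 + N * kappa"
proof -
  define t where "t = m * L"
  define D where "D = 6 * t * cosh t + 6 * t - 12 * sinh t - t ^ 3"
  have t: "0 < t" using m L by (simp add: t_def)
  \<comment> \<open>The sign of D is read off from the hypothesis: a positive N lies below this
    quotient, which excludes D < 0 and also D = 0, where the quotient would be 0.\<close>
  have "0 < 4 * M / L ^ 3 * (3 * t ^ 3 / D)"
    using N N_le by (simp add: sigma_fn_def D_def t_def)
  moreover have "0 < M * t ^ 3" "0 < L ^ 3" using t M L by auto
  ultimately have D: "0 < D"
    by (auto simp: zero_less_mult_iff zero_less_divide_iff)
  have "4 * M / L ^ 3 * (3 * t ^ 3 / D) = 12 * M\<^sup>2 * t / (L * D)"
    using L M D by (simp add: t_def field_simps power3_eq_cube power2_eq_square flip: m(2))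
  then have "N \<le> 12 * M\<^sup>2 * t / (L * D)"
    using N_le by (simp add: sigma_fn_def D_def t_def)
  then have le: "N * (L * D) \<le> 12 * M\<^sup>2 * t"
    using L D by (simp add: pos_le_divide_eq)
  have TS: "T * sinh t = cosh t - 1"
    using sinh_mL by (simp add: T_def t_def)
  \<comment> \<open>The second half-angle form of \<open>T\<close>; together with \<open>TS\<close>
    it eliminates \<open>T\<close> from the difference computed below.\<close>
  have "(cosh t - 1) * (cosh t + 1) = sinh t * sinh t"
    using sinh_square_eq[of t] by (simp add: algebra_simps power2_eq_square)
  then have TC: "T * (cosh t + 1) = sinh t"
    using sinh_mL by (simp add: T_def t_def)
  have "T * sinh t * p1 / M - kappa = (L * (cosh t + 1) / 2 - sinh t / m - L ^ 3 * M / 12) / M\<^sup>2"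
    unfolding TS unfolding TC[symmetric] kappa_def p1_def using m(1) M
    by (simp add: field_simps power2_eq_square)
  also have "\<dots> = L * D / (12 * M\<^sup>2 * t)"
    using m(1) L by (simp add: D_def t_def field_simps power2_eq_square power3_eq_cube flip: m(2))
  finally have "N * (T * sinh t * p1 / M - kappa) = N * (L * D) / (12 * M\<^sup>2 * t)"
    by simp
  also have "\<dots> \<le> 1" using le M t by (simp add: field_simps)
  finally show ?thesis by (simp add: t_def algebra_simps)
qed

lemma kappa_factor_pos: "0 < 1 + N * kappa"
proof -
  have "0 < N * T * sinh (m * L) * p1 / M"
    using N T_pos sinh_mL p1_pos M by simp
  then show ?thesis using kappa_bound by linarith
qed

text \<open>Both factors on the left are bounded by multiples of sinh, so the dependence on x and s
  cancels and only the constants of \<open>kappa_bound\<close> remain to be compared. The point x is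
  measured from the far end: the right side is G(L - x, s) times 1 + N kappa wherever s \<le> L -
  x.\<close>

lemma torsion_psi_le_green:
  assumes "x \<in> {0..L}" "s \<in> {0..L}"
  shows "N * torsion x * psi s \<le> (1 + N * kappa) * (sinh (m * x) * sinh (m * s) / (m * sinh (m * L)))"
proof -
  have "torsion x * psi s \<le> (T * sinh (m * x) / M) * (p1 * sinh (m * s) / m)"
    using assms torsion_nonneg psi_le torsion_le[of x] p1_pos T_pos m M
    by (intro order.trans[OF mult_left_mono mult_right_mono]) auto
  then have "N * (torsion x * psi s) \<le> N * ((T * sinh (m * x) / M) * (p1 * sinh (m * s) / m))"
    using N by (intro mult_left_mono) auto
  also have "\<dots> = (N * T * sinh (m * L) * p1 / M) * (sinh (m * x) * sinh (m * s) / (m * sinh (m * L)))"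
    using L m(1) M by (simp add: field_simps)
  also have "\<dots> \<le> (1 + N * kappa) * (sinh (m * x) * sinh (m * s) / (m * sinh (m * L)))"
    using assms m sinh_mL by (intro mult_right_mono kappa_bound) auto
  finally show ?thesis by (simp add: mult.assoc)
qed

text \<open>The test function below is $R = (1 + N\kappa)\, G(x_0, \cdot) - N e(x_0) \psi$, where $G$ is the
  Green function of $-u'' + Mu$ with zero boundary values, $e = \int G(\cdot, s)\,ds$ is
  \<^const>\<open>torsion\<close>, and $\psi$ solves $-\psi'' + M \psi = s (L - s) / 2$. Testing the equation with
  $R$ leaves only $(1 + N\kappa)\, v(x_0) = \int R f$.\<close>

theorem maximum_principle:
  assumes sol: "lin_sol L M N F v" and mono: "mono_on {0..L} F" and x: "x \<in> {0..L}"
  shows "0 \<le> v x"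
proof -
  obtain v1 where v0: "v 0 = 0" "v L = 0"
    and v: "\<And>x. x \<in> {0..L} \<Longrightarrow> (v has_real_derivative v1 x) (at x within {0..L})"
    and H: "\<And>x. x \<in> {0..L} \<Longrightarrow>
        ((\<lambda>x. v1 x + F x) has_real_derivative M * v x + N * moment L v) (at x within {0..L})"
    using sol unfolding lin_sol_def by blast
  define Q where "Q = 1 + N * kappa"
  define d where "d = N * torsion x"
  define k where "k = Q / (m * sinh (m * L))"
  \<comment> \<open>The two smooth branches of R, left and right of its kink at x. They agree at x,
    and their slopes differ there by Q, which is what isolates v(x).\<close>
  define Rl where "Rl s = k * sinh (m * (L - x)) * sinh (m * s) - d * psi s" for s
  define Rl1 where "Rl1 s = k * sinh (m * (L - x)) * (m * cosh (m * s)) - d * psi1 s" for s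
  define Rr where "Rr s = k * sinh (m * x) * sinh (m * (L - s)) - d * psi s" for s
  define Rr1 where "Rr1 s = k * sinh (m * x) * (- m * cosh (m * (L - s))) - d * psi1 s" for s
  define V where "V s = integral {0..s} (\<lambda>s. s * (L - s) / 2 * v s)" for s
  define C where "C = N * moment L v / M"
  define Gl where "Gl s = Rl s * v1 s - Rl1 s * v s
        - C * (Rl1 s - d * (L * s ^ 2 / 4 - s ^ 3 / 6)) + d * V s" for s
  define Gr where "Gr s = Rr s * v1 s - Rr1 s * v s
        - C * (Rr1 s - d * (L * s ^ 2 / 4 - s ^ 3 / 6)) + d * V s" for s
  have kQ: "k * (sinh (m * y) * sinh (m * z))
      = (1 + N * kappa) * (sinh (m * y) * sinh (m * z) / (m * sinh (m * L)))" for y z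
    by (simp add: k_def Q_def)
  \<comment> \<open>On each side of x one argument is reflected, since the kernel bound measures its
    two points from opposite ends.\<close>
  have Rl0: "0 \<le> Rl s" if "s \<in> {0..x}" for s
    using torsion_psi_le_green[of "L - x" s] that x
    by (simp add: Rl_def d_def torsion_reflect mult.assoc kQ)
  have Rr0: "0 \<le> Rr s" if "s \<in> {x..L}" for s
    using torsion_psi_le_green[of x "L - s"] that x
    by (simp add: Rr_def d_def psi_reflect mult.assoc kQ)
  have dl: "(Rl has_real_derivative Rl1 s) (at s within A)" for s A
    unfolding Rl_def[abs_def] Rl1_def by (auto intro!: derivative_eq_intros psi_deriv)
  have dr: "(Rr has_real_derivative Rr1 s) (at s within A)" for s A
    unfolding Rr_def[abs_def] Rr1_def by (auto intro!: derivative_eq_intros psi_deriv)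
  have dl1: "(Rl1 has_real_derivative M * Rl s + d * (s * (L - s) / 2)) (at s within A)" for s A
  proof -
    have eq: "M * Rl s + d * (s * (L - s) / 2) =
        k * sinh (m * (L - x)) * (m * (sinh (m * s) * m)) - d * (M * psi s - s * (L - s) / 2)"
      by (simp add: Rl_def algebra_simps flip: m(2))
    show ?thesis unfolding eq
      unfolding Rl1_def[abs_def] by (auto intro!: derivative_eq_intros psi1_deriv)
  qed
  have dr1: "(Rr1 has_real_derivative M * Rr s + d * (s * (L - s) / 2)) (at s within A)" for s A
  proof -
    have eq: "M * Rr s + d * (s * (L - s) / 2) =
        k * sinh (m * x) * (m * (sinh (m * (L - s)) * m)) - d * (M * psi s - s * (L - s) / 2)"
      by (simp add: Rr_def algebra_simps flip: m(2))
    show ?thesis unfolding eq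
      unfolding Rr1_def[abs_def] by (auto intro!: derivative_eq_intros psi1_deriv)
  qed
  have "Gl x - Gl 0 \<le> 0"
    by (rule lin_sol_test_piece[OF v H _ _ _ _ dl dl1 Rl0 mono])
       (use M x in \<open>auto simp: Gl_def V_def C_def\<close>)
  moreover have "Gr L - Gr x \<le> 0"
    by (rule lin_sol_test_piece[OF v H _ _ _ _ dr dr1 Rr0 mono])
       (use M x in \<open>auto simp: Gr_def V_def C_def\<close>)
  ultimately have "Gl x - Gl 0 + Gr L - Gr x \<le> 0" by linarith
  moreover have "Rl x = Rr x" by (simp add: Rl_def Rr_def)
  moreover have "Rl 0 = 0" "Rr L = 0" by (auto simp: Rl_def Rr_def)
  moreover have "V 0 = 0" "V L = moment L v" by (auto simp: V_def moment_def)
  moreover have jump: "Rl1 x - Rr1 x = Q"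
  proof -
    have "sinh (m * (L - x)) * cosh (m * x) + sinh (m * x) * cosh (m * (L - x)) = sinh (m * L)"
      using sinh_add[of "m * (L - x)" "m * x"] by (simp add: algebra_simps)
    then have "Rl1 x - Rr1 x = k * m * sinh (m * L)"
      unfolding Rl1_def Rr1_def by (simp add: algebra_simps flip: distrib_left)
    then show ?thesis using m(1) L by (simp add: k_def)
  qed
  ultimately have main: "- Q * v x - C * (Q + Rr1 L - Rl1 0 - d * (L ^ 3 / 12))
      + d * moment L v \<le> 0"
    unfolding Gl_def Gr_def jump[symmetric] using v0
    by (simp add: algebra_simps power2_eq_square power3_eq_cube)
  \<comment> \<open>It remains to see that the nonlocal terms cancel. The factor of C turns out to
    be M e(x), by the choice Q = 1 + N kappa, so C times it equals N e(x) times the moment, which is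
    the term d \<open>moment L v\<close>.\<close>
  have "Rr1 L - Rl1 0 = 2 * d * p1 - k * m * (sinh (m * x) + sinh (m * (L - x)))"
    by (simp add: Rr1_def Rl1_def psi1_ends algebra_simps)
  also have "k * m * (sinh (m * x) + sinh (m * (L - x))) = Q * (1 - M * torsion x)"
    using m M sinh_mL by (simp add: k_def torsion_def)
  finally have "Q + Rr1 L - Rl1 0 - d * (L ^ 3 / 12) = Q * M * torsion x + d * (2 * p1 - L ^ 3 / 12)"
    by (simp add: algebra_simps)
  also have "\<dots> = M * torsion x"
    using M by (simp add: Q_def d_def kappa_def field_simps)
  finally have "0 \<le> Q * v x"
    using main M by (simp add: d_def C_def)
  then show ?thesis
    using kappa_factor_pos by (simp add: Q_def zero_le_mult_iff)
qed

end

section \<open>Comparison, existence and limits\<close>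

lemma moment_integrable:
  "continuous_on {0..L} v \<Longrightarrow> (\<lambda>s. s * (L - s) / 2 * v s) integrable_on {0..L}" for L :: real
  by (intro integrable_continuous_interval continuous_intros) auto

lemma moment_diff:
  assumes "continuous_on {0..L} v" "continuous_on {0..L} w"
  shows "moment L (\<lambda>x. v x - w x) = moment L v - moment L w"
  unfolding moment_def integral_diff[OF assms[THEN moment_integrable], symmetric]
  by (rule integral_cong) (simp add: field_simps)

lemma moment_cmult: "moment L (\<lambda>x. c * v x) = c * moment L v"
  unfolding moment_def by (subst integral_mult_right[symmetric]) (simp add: mult.left_commute)

lemma moment_mono:
  assumes "continuous_on {0..L} v" "continuous_on {0..L} w" "\<And>x. x \<in> {0..L} \<Longrightarrow> v x \<le> w x"
  shows "moment L v \<le> moment L w"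
  unfolding moment_def using assms
  by (intro integral_le moment_integrable mult_left_mono) auto

lemma moment_nonneg: "(\<And>x. x \<in> {0..L} \<Longrightarrow> 0 \<le> v x) \<Longrightarrow> 0 \<le> moment L v"
  unfolding moment_def by (cases "(\<lambda>s. s * (L - s) / 2 * v s) integrable_on {0..L}")
    (auto intro!: integral_nonneg simp: not_integrable_integral)

lemma lin_sol_diff:
  assumes "lin_sol L M N F v" "lin_sol L M N G w"
  shows "lin_sol L M N (\<lambda>x. F x - G x) (\<lambda>x. v x - w x)"
proof -
  note mom = moment_diff[OF assms[THEN lin_sol_continuous]]
  obtain v1 where v: "v 0 = 0" "v L = 0"
    "\<And>x. x \<in> {0..L} \<Longrightarrow> (v has_real_derivative v1 x) (at x within {0..L})"
    "\<And>x. x \<in> {0..L} \<Longrightarrow>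
        ((\<lambda>x. v1 x + F x) has_real_derivative M * v x + N * moment L v) (at x within {0..L})"
    using assms(1) unfolding lin_sol_def by blast
  obtain w1 where w: "w 0 = 0" "w L = 0"
    "\<And>x. x \<in> {0..L} \<Longrightarrow> (w has_real_derivative w1 x) (at x within {0..L})"
    "\<And>x. x \<in> {0..L} \<Longrightarrow>
        ((\<lambda>x. w1 x + G x) has_real_derivative M * w x + N * moment L w) (at x within {0..L})"
    using assms(2) unfolding lin_sol_def by blast
  have "((\<lambda>x. v1 x - w1 x + (F x - G x)) has_real_derivative
      M * (v x - w x) + N * moment L (\<lambda>x. v x - w x)) (at x within {0..L})" if "x \<in> {0..L}" for x
    using DERIV_diff[OF v(4)[OF that] w(4)[OF that]] by (simp add: mom algebra_simps)
  then show ?thesis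
    unfolding lin_sol_def using v w
    by (intro conjI exI[of _ "\<lambda>x. v1 x - w1 x"]) (auto intro!: DERIV_diff)
qed

context nonlocal_plate
begin

lemma comparison:
  assumes "lin_sol L M N F v" "lin_sol L M N G w" "mono_on {0..L} (\<lambda>x. G x - F x)" "x \<in> {0..L}"
  shows "v x \<le> w x"
  using maximum_principle[OF lin_sol_diff[OF assms(2,1)] assms(3,4)] by simp

text \<open>The local problem is solved by variation of constants, and the nonlocal term, being a
  constant, is then supplied by a multiple of \<open>torsion\<close>.\<close>

lemma lin_sol_exists:
  assumes F: "continuous_on {0..L} F"
  shows "\<exists>v. lin_sol L M N F v"
proof -
  define A where "A x = integral {0..x} (\<lambda>s. cosh (m * s) * F s)" for x
  define B where "B x = integral {0..x} (\<lambda>s. sinh (m * s) * F s)" for x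
  define h where "h x = sinh (m * x) * B x - cosh (m * x) * A x" for x
  define k where "k = h L / sinh (m * L)"
  define g where "g x = h x - k * sinh (m * x)" for x
  \<comment> \<open>The solution of d = N (moment of g - d moment of torsion). The denominator is at
    least 1 because \<open>torsion\<close> is nonnegative.\<close>
  define d where "d = N * moment L g / (1 + N * moment L torsion)"
  define v where "v x = g x - d * torsion x" for x
  define g1 where "g1 x = m * (cosh (m * x) * B x - sinh (m * x) * A x - k * cosh (m * x))" for x
  have dA: "(A has_real_derivative cosh (m * x) * F x) (at x within {0..L})"
    and dB: "(B has_real_derivative sinh (m * x) * F x) (at x within {0..L})"
    if "x \<in> {0..L}" for x
    unfolding A_def[abs_def] B_def[abs_def]
    using that by (auto intro!: integral_has_real_derivative continuous_intros F)
  have dg: "(g has_real_derivative g1 x - F x) (at x within {0..L})"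
    and dg1: "(g1 has_real_derivative M * g x) (at x within {0..L})" if x: "x \<in> {0..L}" for x
  proof -
    have eq: "g1 x - F x = g1 x - (cosh (m * x) * cosh (m * x) - sinh (m * x) * sinh (m * x)) * F x"
      using hyperbolic_pythagoras[of "m * x"] by (simp add: power2_eq_square)
    show "(g has_real_derivative g1 x - F x) (at x within {0..L})"
      unfolding eq unfolding g_def[abs_def] h_def
      by (auto intro!: derivative_eq_intros dA dB x simp: g1_def algebra_simps)
    show "(g1 has_real_derivative M * g x) (at x within {0..L})"
      unfolding g1_def[abs_def]
      by (auto intro!: derivative_eq_intros dA dB x simp: g_def h_def algebra_simps simp flip: m(2))
  qed
  have cont: "continuous_on {0..L} g" "continuous_on {0..L} torsion"
    by (auto intro!: DERIV_continuous_on dg torsion_deriv)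
  have "0 \<le> N * moment L torsion"
    using N moment_nonneg torsion_nonneg by simp
  then have "d = N * (moment L g - d * moment L torsion)"
    by (simp add: d_def field_simps)
  also have "moment L g - d * moment L torsion = moment L v"
    unfolding v_def using cont
    by (subst moment_diff) (auto intro!: continuous_intros simp: moment_cmult)
  finally have d: "N * moment L v = d" by simp
  have g0: "g 0 = 0" "g L = 0"
    using m(1) L by (auto simp: g_def h_def A_def B_def k_def)
  have "lin_sol L M N F v"
    unfolding lin_sol_def d
  proof (intro conjI exI[of _ "\<lambda>x. g1 x - F x - d * torsion1 x"] ballI)
    fix x assume x: "x \<in> {0..L}"
    show "(v has_real_derivative g1 x - F x - d * torsion1 x) (at x within {0..L})"
      unfolding v_def[abs_def] by (auto intro!: derivative_eq_intros dg x torsion_deriv)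
    have "((\<lambda>x. g1 x - d * torsion1 x) has_real_derivative M * g x - d * (M * torsion x - 1))
        (at x within {0..L})"
      by (auto intro!: derivative_eq_intros dg1 x torsion1_deriv)
    then show "((\<lambda>x. g1 x - F x - d * torsion1 x + F x) has_real_derivative M * v x + d)
        (at x within {0..L})"
      by (simp add: v_def algebra_simps)
  qed (auto simp: v_def g0)
  then show ?thesis by blast
qed

lemma lin_sol_unique:
  assumes "lin_sol L M N F v" "lin_sol L M N G w" "\<And>x. x \<in> {0..L} \<Longrightarrow> F x = G x" "x \<in> {0..L}"
  shows "v x = w x"
proof (rule order.antisym)
  show "v x \<le> w x" "w x \<le> v x"
    using assms by (auto intro!: comparison[OF assms(1,2)] comparison[OF assms(2,1)] mono_onI)
qed

end

text \<open>The twice integrated equation is stable under bounded pointwise convergence, and since its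
  right-hand side is continuous, the limit is automatically a classical solution.\<close>

lemma lin_sol_integrated:
  assumes "lin_sol L M N F v" "F 0 = 0"
  obtains k where "\<And>x. x \<in> {0..L} \<Longrightarrow>
    v x = k * x + integral {0..x} (\<lambda>s. M * integral {0..s} v + N * moment L v * s - F s)"
proof -
  obtain v1 where v0: "v 0 = 0"
    and v: "\<And>x. x \<in> {0..L} \<Longrightarrow> (v has_real_derivative v1 x) (at x within {0..L})"
    and H: "\<And>x. x \<in> {0..L} \<Longrightarrow>
        ((\<lambda>x. v1 x + F x) has_real_derivative M * v x + N * moment L v) (at x within {0..L})"
    using assms(1) unfolding lin_sol_def by blast
  note cv = lin_sol_continuous[OF assms(1)]
  have v1: "v1 x = v1 0 + (M * integral {0..x} v + N * moment L v * x - F x)" if x: "x \<in> {0..L}" for x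
  proof -
    have "((\<lambda>s. M * v s + N * moment L v) has_integral (v1 x + F x - (v1 0 + F 0))) {0..x}"
      using x by (intro has_integral_real_derivative) (auto intro!: DERIV_subset[OF H])
    moreover have "((\<lambda>s. M * v s + N * moment L v) has_integral
        (M * integral {0..x} v + N * moment L v * x)) {0..x}"
    proof -
      have "continuous_on {0..x} v" using continuous_on_subset[OF cv] x by auto
      then have "(v has_integral integral {0..x} v) {0..x}"
        using integrable_continuous_interval by blast
      moreover have "((\<lambda>s. N * moment L v) has_integral N * moment L v * x) {0..x}"
        using has_integral_const_real[of "N * moment L v" 0 x] x by (simp add: mult.commute)
      ultimately show ?thesis by (intro has_integral_add has_integral_mult_right)
    qed
    ultimately have "v1 x + F x - (v1 0 + F 0) = M * integral {0..x} v + N * moment L v * x"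
      by (rule has_integral_unique)
    then show ?thesis using assms(2) by simp
  qed
  have "v x = v1 0 * x + integral {0..x} (\<lambda>s. M * integral {0..s} v + N * moment L v * s - F s)"
    if x: "x \<in> {0..L}" for x
  proof -
    have "(v1 has_integral (v x - v 0)) {0..x}"
      using x by (intro has_integral_real_derivative) (auto intro!: DERIV_subset[OF v])
    from has_integral_diff[OF this has_integral_const_real[of "v1 0" 0 x]]
    have "((\<lambda>s. v1 s - v1 0) has_integral (v x - v1 0 * x)) {0..x}"
      using x v0 by (simp add: mult.commute)
    moreover have "v1 s - v1 0 = M * integral {0..s} v + N * moment L v * s - F s"
      if "s \<in> {0..x}" for s
      using v1[of s] x that by simp
    ultimately have "((\<lambda>s. M * integral {0..s} v + N * moment L v * s - F s)
        has_integral (v x - v1 0 * x)) {0..x}"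
      by (metis (no_types, lifting) has_integral_eq)
    then show ?thesis by (simp add: integral_unique)
  qed
  then show thesis by (rule that)
qed

lemma bounded_pointwise_integral:
  fixes f :: "nat \<Rightarrow> real \<Rightarrow> real"
  assumes "\<And>n. continuous_on {a..b} (f n)" "\<And>n x. x \<in> {a..b} \<Longrightarrow> \<bar>f n x\<bar> \<le> C"
    and "\<And>x. x \<in> {a..b} \<Longrightarrow> (\<lambda>n. f n x) \<longlonglongrightarrow> g x"
  shows "g integrable_on {a..b}" "(\<lambda>n. integral {a..b} (f n)) \<longlonglongrightarrow> integral {a..b} g"
proof -
  have "f n integrable_on {a..b}" for n
    using assms(1) by (rule integrable_continuous_interval)
  then show "g integrable_on {a..b}" "(\<lambda>n. integral {a..b} (f n)) \<longlonglongrightarrow> integral {a..b} g"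
    using dominated_convergence[of f "{a..b}" "\<lambda>_. C" g] assms(2,3) by auto
qed

lemma moment_tendsto:
  assumes L: "0 < L" and cv: "\<And>n. continuous_on {0..L} (v n)"
    and vB: "\<And>n x. x \<in> {0..L} \<Longrightarrow> \<bar>v n x\<bar> \<le> C"
    and vlim: "\<And>x. x \<in> {0..L} \<Longrightarrow> (\<lambda>n. v n x) \<longlonglongrightarrow> w x"
  shows "(\<lambda>n. moment L (v n)) \<longlonglongrightarrow> moment L w"
proof -
  have C0: "0 \<le> C" using vB[of 0 0] L by auto
  show ?thesis
    unfolding moment_def
  proof (rule bounded_pointwise_integral(2))
    show "continuous_on {0..L} (\<lambda>s. s * (L - s) / 2 * v n s)" for n
      by (intro continuous_intros cv) auto
    show "\<bar>x * (L - x) / 2 * v n x\<bar> \<le> L * L * C" if "x \<in> {0..L}" for n x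
    proof -
      have "0 \<le> x * (L - x)" "x * (L - x) \<le> L * L"
        using that L by (auto intro!: mult_mono)
      then have "\<bar>x * (L - x) / 2\<bar> \<le> L * L" by linarith
      then show ?thesis
        unfolding abs_mult[of "x * (L - x) / 2"] using vB[OF that] C0 by (intro mult_mono) auto
    qed
  qed (auto intro!: tendsto_intros vlim)
qed

lemma lin_sol_limit:
  assumes L: "0 < L"
    and sol: "\<And>n. lin_sol L M N (F n) (v n)"
    and F: "\<And>n. continuous_on {0..L} (F n)" "\<And>n. F n 0 = 0"
    and FB: "\<And>n x. x \<in> {0..L} \<Longrightarrow> \<bar>F n x\<bar> \<le> B"
    and Flim: "\<And>x. x \<in> {0..L} \<Longrightarrow> (\<lambda>n. F n x) \<longlonglongrightarrow> G x" and G: "continuous_on {0..L} G"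
    and vB: "\<And>n x. x \<in> {0..L} \<Longrightarrow> \<bar>v n x\<bar> \<le> C"
    and vlim: "\<And>x. x \<in> {0..L} \<Longrightarrow> (\<lambda>n. v n x) \<longlonglongrightarrow> w x"
  shows "lin_sol L M N G w"
proof -
  have cv: "continuous_on {0..L} (v n)" for n using lin_sol_continuous[OF sol] .
  have C0: "0 \<le> C" using vB[of 0 0] L by auto
  have cvx: "continuous_on {0..x} (v n)" if "x \<in> {0..L}" for n x
    using continuous_on_subset[OF cv] that by auto
  have lim1: "w integrable_on {0..x}" "(\<lambda>n. integral {0..x} (v n)) \<longlonglongrightarrow> integral {0..x} w"
    if "x \<in> {0..L}" for x
    using bounded_pointwise_integral[of 0 x v C w] cvx[OF that] vB vlim that by auto
  have mom: "(\<lambda>n. moment L (v n)) \<longlonglongrightarrow> moment L w"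
    using L cv vB vlim by (rule moment_tendsto)
  obtain D where D: "\<And>n. \<bar>moment L (v n)\<bar> \<le> D"
    using convergent_imp_Bseq[OF convergentI[OF mom]] unfolding Bseq_def by auto
  have D0: "0 \<le> D" using D[of 0] by linarith
  define q where "q n s = M * integral {0..s} (v n) + N * moment L (v n) * s - F n s" for n s
  define r where "r s = M * integral {0..s} w + N * moment L w * s - G s" for s
  have qlim: "(\<lambda>n. q n s) \<longlonglongrightarrow> r s" if "s \<in> {0..L}" for s
    unfolding q_def r_def using that by (intro tendsto_intros lim1 mom Flim)
  have cI: "continuous_on {0..L} (\<lambda>s. integral {0..s} f)" if "f integrable_on {0..L}" for f :: "real \<Rightarrow> real"
    using indefinite_integral_continuous_1[OF that] .
  have wint: "w integrable_on {0..L}" using lim1[of L] L by simp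
  have cq: "continuous_on {0..L} (q n)" for n
    unfolding q_def by (intro continuous_intros cI F integrable_continuous_interval cv)
  have cr: "continuous_on {0..L} r"
    unfolding r_def by (intro continuous_intros cI G wint)
  have qB: "\<bar>q n s\<bar> \<le> \<bar>M\<bar> * (C * L) + \<bar>N\<bar> * D * L + B" if s: "s \<in> {0..L}" for n s
  proof -
    have "norm (integral {0..s} (v n)) \<le> C * (s - 0)"
      using s by (intro integral_bound cvx) (auto intro!: vB)
    also have "\<dots> \<le> C * L" using s C0 by (simp add: mult_left_mono)
    finally have "\<bar>M * integral {0..s} (v n)\<bar> \<le> \<bar>M\<bar> * (C * L)"
      by (simp add: abs_mult mult_left_mono)
    moreover have "\<bar>N * moment L (v n) * s\<bar> \<le> \<bar>N\<bar> * D * L"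
      unfolding abs_mult using D s L D0 by (intro mult_mono) auto
    ultimately show ?thesis
      unfolding q_def using FB[OF s, of n] by linarith
  qed
  have "\<exists>k. \<forall>x\<in>{0..L}. v n x = k * x + integral {0..x} (q n)" for n
    using lin_sol_integrated[OF sol F(2)] unfolding q_def by metis
  then obtain k where k: "\<And>n x. x \<in> {0..L} \<Longrightarrow> v n x = k n * x + integral {0..x} (q n)"
    by metis
  have intq: "(\<lambda>n. integral {0..x} (q n)) \<longlonglongrightarrow> integral {0..x} r" if "x \<in> {0..L}" for x
    using that by (intro bounded_pointwise_integral(2)[OF continuous_on_subset[OF cq] qB qlim]) auto
  have end0: "v n 0 = 0" "v n L = 0" for n using sol unfolding lin_sol_def by auto
  \<comment> \<open>The boundary value at L determines the slope, so the slopes converge along with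
    the integrals.\<close>
  have kL: "k n = (- 1 / L) * integral {0..L} (q n)" for n
  proof -
    have "k n * L = - integral {0..L} (q n)"
      using k[of L n] L end0[of n] by simp
    then show ?thesis
      using L by (simp add: field_simps)
  qed
  have klim: "k \<longlonglongrightarrow> (- 1 / L) * integral {0..L} r"
    unfolding kL[abs_def] using L by (intro tendsto_mult[OF tendsto_const intq]) simp
  define j where "j = (- 1 / L) * integral {0..L} r"
  have w: "w x = j * x + integral {0..x} r" if x: "x \<in> {0..L}" for x
  proof (rule LIMSEQ_unique[OF vlim[OF x]])
    show "(\<lambda>n. v n x) \<longlonglongrightarrow> j * x + integral {0..x} r"
      unfolding k[OF x] j_def by (intro tendsto_add tendsto_mult klim intq x tendsto_const)
  qed
  have dw: "(w has_real_derivative j + r x) (at x within {0..L})" if x: "x \<in> {0..L}" for x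
  proof -
    have "((\<lambda>x. j * x + integral {0..x} r) has_real_derivative j + r x) (at x within {0..L})"
      by (auto intro!: derivative_eq_intros integral_has_real_derivative[OF cr x])
    then show ?thesis
      by (rule has_field_derivative_transform_within[OF _ zero_less_one x]) (simp add: w)
  qed
  \<comment> \<open>Bootstrap: integrability of w made r continuous, hence w differentiable. Only
    now can the integral of w inside r be differentiated.\<close>
  have cw: "continuous_on {0..L} w" using dw by (rule DERIV_continuous_on)
  have "((\<lambda>x. j + r x + G x) has_real_derivative M * w x + N * moment L w) (at x within {0..L})"
    if x: "x \<in> {0..L}" for x
  proof -
    have "((\<lambda>x. j + (M * integral {0..x} w + N * moment L w * x)) has_real_derivative
        M * w x + N * moment L w) (at x within {0..L})"
      by (auto intro!: derivative_eq_intros integral_has_real_derivative[OF cw x])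
    then show ?thesis by (simp add: r_def)
  qed
  moreover have "w 0 = 0" "w L = 0"
    using w[of 0] w[of L] L by (auto simp: j_def)
  ultimately show ?thesis
    unfolding lin_sol_def using dw by (intro conjI exI[of _ "\<lambda>x. j + r x"] ballI) auto
qed

section \<open>Recovering the fourth order problem\<close>

text \<open>The Green operator of -y'' = v with zero boundary values, its kernel min(x,s) (L -
  max(x,s)) / L split at s = x. It recovers y from v = -y''.\<close>

definition dirichlet_inv :: "real \<Rightarrow> (real \<Rightarrow> real) \<Rightarrow> real \<Rightarrow> real" where
  "dirichlet_inv L v x =
     ((L - x) * integral {0..x} (\<lambda>s. s * v s) + x * integral {x..L} (\<lambda>s. (L - s) * v s)) / L"

definition dirichlet_inv1 :: "real \<Rightarrow> (real \<Rightarrow> real) \<Rightarrow> real \<Rightarrow> real" where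
  "dirichlet_inv1 L v x = (integral {x..L} (\<lambda>s. (L - s) * v s) - integral {0..x} (\<lambda>s. s * v s)) / L"

lemma dirichlet_inv_ends [simp]: "dirichlet_inv L v 0 = 0" "dirichlet_inv L v L = 0"
  by (auto simp: dirichlet_inv_def)

lemma dirichlet_inv_deriv:
  assumes "L \<noteq> 0" and v: "continuous_on {0..L} v" and x: "x \<in> {0..L}"
  shows "(dirichlet_inv L v has_real_derivative dirichlet_inv1 L v x) (at x within {0..L})"
    and "(dirichlet_inv1 L v has_real_derivative - v x) (at x within {0..L})"
proof -
  have d1: "((\<lambda>x. integral {0..x} (\<lambda>s. s * v s)) has_real_derivative x * v x) (at x within {0..L})"
    by (rule integral_has_real_derivative[OF _ x]) (intro continuous_intros v)
  have d2: "((\<lambda>x. integral {x..L} (\<lambda>s. (L - s) * v s)) has_real_derivative - ((L - x) * v x))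
      (at x within {0..L})"
    by (rule integral_has_real_derivative'[OF _ x]) (intro continuous_intros v)
  show "(dirichlet_inv L v has_real_derivative dirichlet_inv1 L v x) (at x within {0..L})"
    unfolding dirichlet_inv_def[abs_def] dirichlet_inv1_def
    by (rule DERIV_cdivide, rule DERIV_cong, rule DERIV_add, rule DERIV_mult, rule DERIV_diff,
        rule DERIV_const, rule DERIV_ident, rule d1, rule DERIV_mult, rule DERIV_ident, rule d2)
       (simp add: algebra_simps)
  show "(dirichlet_inv1 L v has_real_derivative - v x) (at x within {0..L})"
    unfolding dirichlet_inv1_def[abs_def] using \<open>L \<noteq> 0\<close>
    using DERIV_cdivide[OF DERIV_diff[OF d2 d1], of L] by (simp add: field_simps)
qed

lemma second_deriv_zero_imp_zero:
  fixes y y1 :: "real \<Rightarrow> real"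
  assumes L: "0 < L"
    and y: "\<And>x. x \<in> {0..L} \<Longrightarrow> (y has_real_derivative y1 x) (at x within {0..L})"
    and y1: "\<And>x. x \<in> {0..L} \<Longrightarrow> (y1 has_real_derivative 0) (at x within {0..L})"
    and ends: "y 0 = 0" "y L = 0" and x: "x \<in> {0..L}"
  shows "y x = 0"
proof -
  obtain k where k: "\<And>x. x \<in> {0..L} \<Longrightarrow> y1 x = k"
    using has_field_derivative_zero_constant[of "{0..L}" y1] y1 by auto
  have "((\<lambda>x. y x - k * x) has_real_derivative 0) (at x within {0..L})" if "x \<in> {0..L}" for x
    using y[OF that] k[OF that] by (auto intro!: derivative_eq_intros)
  then obtain d where d: "\<And>x. x \<in> {0..L} \<Longrightarrow> y x - k * x = d"
    using has_field_derivative_zero_constant[of "{0..L}" "\<lambda>x. y x - k * x"] by auto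
  have "d = 0" using d[of 0] ends L by simp
  moreover from this have "k = 0" using d[of L] ends L by simp
  ultimately show ?thesis using d[OF x] by simp
qed

lemma dirichlet_inv_eqI:
  assumes L: "0 < L" and v: "continuous_on {0..L} v"
    and y: "\<And>x. x \<in> {0..L} \<Longrightarrow> (y has_real_derivative y1 x) (at x within {0..L})"
    and y1: "\<And>x. x \<in> {0..L} \<Longrightarrow> (y1 has_real_derivative - v x) (at x within {0..L})"
    and ends: "y 0 = 0" "y L = 0" and x: "x \<in> {0..L}"
  shows "y x = dirichlet_inv L v x"
proof -
  have "(\<lambda>x. y x - dirichlet_inv L v x) x = 0"
  proof (rule second_deriv_zero_imp_zero[OF L _ _ _ _ x])
    fix x assume x: "x \<in> {0..L}"
    note d = dirichlet_inv_deriv[OF _ v x]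
    show "((\<lambda>x. y x - dirichlet_inv L v x) has_real_derivative y1 x - dirichlet_inv1 L v x)
        (at x within {0..L})"
      using d(1) L y[OF x] by (auto intro!: DERIV_diff)
    show "((\<lambda>x. y1 x - dirichlet_inv1 L v x) has_real_derivative 0) (at x within {0..L})"
      using DERIV_diff[OF y1[OF x] d(2)] L by simp
  qed (auto simp: ends)
  then show ?thesis by simp
qed

text \<open>Two integrations by parts against s(L-s)/2, whose second derivative is -1 and which
  vanishes at both ends; \<open>?f\<close> collects the boundary terms.\<close>

lemma integral_eq_moment:
  assumes L: "0 < L" and v: "continuous_on {0..L} v"
    and y: "\<And>x. x \<in> {0..L} \<Longrightarrow> (y has_real_derivative y1 x) (at x within {0..L})"
    and y1: "\<And>x. x \<in> {0..L} \<Longrightarrow> (y1 has_real_derivative - v x) (at x within {0..L})"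
    and ends: "y 0 = 0" "y L = 0"
  shows "integral {0..L} y = moment L v"
proof -
  let ?f = "\<lambda>s. s * (L - s) / 2 * y1 s - (L / 2 - s) * y s"
  have "((\<lambda>s. y s - s * (L - s) / 2 * v s) has_integral (?f L - ?f 0)) {0..L}"
  proof (rule has_integral_real_derivative)
    fix x assume x: "x \<in> {0..L}"
    show "(?f has_real_derivative y x - x * (L - x) / 2 * v x) (at x within {0..L})"
      by (auto intro!: derivative_eq_intros y[OF x] y1[OF x] simp: field_simps)
  qed (use L in auto)
  then have "integral {0..L} (\<lambda>s. y s - s * (L - s) / 2 * v s) = 0"
    using ends by (simp add: integral_unique)
  moreover have "integral {0..L} (\<lambda>s. y s - s * (L - s) / 2 * v s)
      = integral {0..L} y - moment L v"
    unfolding moment_def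
    by (intro integral_diff moment_integrable v integrable_continuous_interval
        DERIV_continuous_on[OF y])
  ultimately show ?thesis by simp
qed

lemma integral_dirichlet_inv:
  assumes "0 < L" "continuous_on {0..L} v"
  shows "integral {0..L} (dirichlet_inv L v) = moment L v"
  using assms dirichlet_inv_deriv[OF _ assms(2)] by (intro integral_eq_moment) auto

lemma dirichlet_inv_mono:
  assumes L: "0 < L" and v: "continuous_on {0..L} v" and w: "continuous_on {0..L} w"
    and le: "\<And>x. x \<in> {0..L} \<Longrightarrow> v x \<le> w x" and x: "x \<in> {0..L}"
  shows "dirichlet_inv L v x \<le> dirichlet_inv L w x"
proof -
  have c: "continuous_on {0..x} v" "continuous_on {0..x} w"
    "continuous_on {x..L} v" "continuous_on {x..L} w"
    using x by (auto intro: continuous_on_subset[OF v] continuous_on_subset[OF w])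
  have "integral {0..x} (\<lambda>s. s * v s) \<le> integral {0..x} (\<lambda>s. s * w s)"
    using x le by (intro integral_le integrable_continuous_interval continuous_intros c)
      (auto intro!: mult_left_mono)
  moreover have "integral {x..L} (\<lambda>s. (L - s) * v s) \<le> integral {x..L} (\<lambda>s. (L - s) * w s)"
    using x le by (intro integral_le integrable_continuous_interval continuous_intros c)
      (auto intro!: mult_left_mono)
  ultimately show ?thesis
    unfolding dirichlet_inv_def using L x
    by (intro divide_right_mono add_mono mult_left_mono) auto
qed

lemma dirichlet_inv_diff:
  assumes v: "continuous_on {0..L} v" and w: "continuous_on {0..L} w" and x: "x \<in> {0..L}"
  shows "dirichlet_inv L (\<lambda>s. v s - w s) x = dirichlet_inv L v x - dirichlet_inv L w x"
proof -
  have c: "continuous_on {0..x} v" "continuous_on {0..x} w"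
    "continuous_on {x..L} v" "continuous_on {x..L} w"
    using x by (auto intro: continuous_on_subset[OF v] continuous_on_subset[OF w])
  have "integral {0..x} (\<lambda>s. s * v s - s * w s)
      = integral {0..x} (\<lambda>s. s * v s) - integral {0..x} (\<lambda>s. s * w s)"
    by (intro integral_diff integrable_continuous_interval continuous_intros c)
  moreover have "integral {x..L} (\<lambda>s. (L - s) * v s - (L - s) * w s)
      = integral {x..L} (\<lambda>s. (L - s) * v s) - integral {x..L} (\<lambda>s. (L - s) * w s)"
    by (intro integral_diff integrable_continuous_interval continuous_intros c)
  moreover have "(\<lambda>s. s * (v s - w s)) = (\<lambda>s. s * v s - s * w s)"
    "(\<lambda>s. (L - s) * (v s - w s)) = (\<lambda>s. (L - s) * v s - (L - s) * w s)"
    by (auto simp: right_diff_distrib)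
  ultimately show ?thesis
    unfolding dirichlet_inv_def by (simp only: diff_divide_distrib[symmetric]) (simp add: algebra_simps)
qed

lemma abs_dirichlet_inv_le:
  assumes L: "0 < L" and v: "continuous_on {0..L} v" and x: "x \<in> {0..L}"
  shows "\<bar>dirichlet_inv L v x\<bar> \<le> L * integral {0..L} (\<lambda>s. \<bar>v s\<bar>)"
proof -
  let ?I = "L * integral {0..L} (\<lambda>s. \<bar>v s\<bar>)"
  have piece: "\<bar>integral {c..d} (\<lambda>s. k s * v s)\<bar> \<le> ?I"
    if cd: "0 \<le> c" "d \<le> L" and k: "continuous_on {c..d} k" "\<And>s. s \<in> {c..d} \<Longrightarrow> \<bar>k s\<bar> \<le> L" for c d k
  proof -
    have sub: "{c..d} \<subseteq> {0..L}" using cd by auto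
    note cv = continuous_on_subset[OF v sub]
    have "\<bar>integral {c..d} (\<lambda>s. k s * v s)\<bar> \<le> integral {c..d} (\<lambda>s. L * \<bar>v s\<bar>)"
      unfolding real_norm_def[symmetric]
      by (rule integral_norm_bound_integral)
         (auto intro!: integrable_continuous_interval continuous_intros cv k mult_right_mono
               simp: abs_mult)
    also have "\<dots> \<le> integral {0..L} (\<lambda>s. L * \<bar>v s\<bar>)"
      using L by (intro integral_subset_le sub integrable_continuous_interval continuous_intros v cv) auto
    finally show ?thesis by simp
  qed
  have "\<bar>(L - x) * integral {0..x} (\<lambda>s. s * v s) + x * integral {x..L} (\<lambda>s. (L - s) * v s)\<bar>
      \<le> (L - x) * ?I + x * ?I"
  proof (rule order.trans[OF abs_triangle_ineq add_mono])
    have "\<bar>integral {0..x} (\<lambda>s. s * v s)\<bar> \<le> ?I" "\<bar>integral {x..L} (\<lambda>s. (L - s) * v s)\<bar> \<le> ?I"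
      using x by (intro piece continuous_intros; auto)+
    then show "\<bar>(L - x) * integral {0..x} (\<lambda>s. s * v s)\<bar> \<le> (L - x) * ?I"
      "\<bar>x * integral {x..L} (\<lambda>s. (L - s) * v s)\<bar> \<le> x * ?I"
      using x unfolding abs_mult[of "L - x"] abs_mult[of x] by (auto intro!: mult_left_mono)
  qed
  also have "\<dots> = L * ?I" by (simp add: algebra_simps)
  finally show ?thesis
    using L by (simp add: dirichlet_inv_def divide_le_eq mult.commute)
qed

text \<open>The Green operator maps L^1 boundedly into the sup norm, and dominated convergence gives
  L^1 convergence of v. Hence pointwise convergence of the second derivatives is enough for uniform
  convergence of the functions.\<close>

lemma dirichlet_inv_uniform_limit:
  assumes L: "0 < L" and v: "\<And>n. continuous_on {0..L} (v n)" and w: "continuous_on {0..L} w"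
    and vB: "\<And>n x. x \<in> {0..L} \<Longrightarrow> \<bar>v n x\<bar> \<le> C"
    and lim: "\<And>x. x \<in> {0..L} \<Longrightarrow> (\<lambda>n. v n x) \<longlonglongrightarrow> w x"
  shows "uniform_limit {0..L} (\<lambda>n. dirichlet_inv L (v n)) (dirichlet_inv L w) sequentially"
proof -
  have wB: "\<bar>w x\<bar> \<le> C" if "x \<in> {0..L}" for x
    using tendsto_rabs[OF lim[OF that]] vB[OF that] by (intro LIMSEQ_le_const2) auto
  have "(\<lambda>n. integral {0..L} (\<lambda>s. \<bar>v n s - w s\<bar>)) \<longlonglongrightarrow> integral {0..L} (\<lambda>_. 0)"
  proof (rule bounded_pointwise_integral(2))
    show "\<bar>\<bar>v n x - w x\<bar>\<bar> \<le> 2 * C" if "x \<in> {0..L}" for n x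
      using vB[OF that, of n] wB[OF that] by linarith
    show "(\<lambda>n. \<bar>v n x - w x\<bar>) \<longlonglongrightarrow> 0" if "x \<in> {0..L}" for x
      using LIM_zero[OF lim[OF that]] by (rule tendsto_rabs_zero)
  qed (intro continuous_intros v w)
  then have "(\<lambda>n. L * integral {0..L} (\<lambda>s. \<bar>v n s - w s\<bar>)) \<longlonglongrightarrow> L * 0"
    by (intro tendsto_mult) auto
  then have lim0: "(\<lambda>n. L * integral {0..L} (\<lambda>s. \<bar>v n s - w s\<bar>)) \<longlonglongrightarrow> 0" by simp
  show ?thesis
  proof (rule uniform_limitI)
    fix e :: real assume "0 < e"
    then have "\<forall>\<^sub>F n in sequentially. L * integral {0..L} (\<lambda>s. \<bar>v n s - w s\<bar>) < e"
      using lim0 by (rule order_tendstoD(2)[rotated])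
    then show "\<forall>\<^sub>F n in sequentially. \<forall>x\<in>{0..L}. dist (dirichlet_inv L (v n) x) (dirichlet_inv L w x) < e"
    proof (rule eventually_mono, intro ballI)
      fix n x assume n: "L * integral {0..L} (\<lambda>s. \<bar>v n s - w s\<bar>) < e" and x: "x \<in> {0..L}"
      have "\<bar>dirichlet_inv L (\<lambda>s. v n s - w s) x\<bar> \<le> L * integral {0..L} (\<lambda>s. \<bar>v n s - w s\<bar>)"
        by (intro abs_dirichlet_inv_le L x continuous_intros v w)
      then show "dist (dirichlet_inv L (v n) x) (dirichlet_inv L w x) < e"
        using n by (simp add: dist_real_def dirichlet_inv_diff[OF v w x])
    qed
  qed
qed

section \<open>Almost everywhere equations and their primitives\<close>

lemma AE_interval_negligible:
  fixes L :: real
  assumes "AE x in lborel. x \<in> {0<..<L} \<longrightarrow> Q x"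
  obtains S where "negligible S" "\<And>x. x \<in> {0..L} - S \<Longrightarrow> Q x"
proof -
  obtain S where S: "S \<in> null_sets lborel" "\<And>x. x \<in> space lborel - S \<Longrightarrow> x \<in> {0<..<L} \<longrightarrow> Q x"
    using AE_E3[OF assms] by auto
  have "negligible S"
    using null_sets_completionI[OF S(1)] by (simp add: negligible_iff_null_sets)
  \<comment> \<open>The endpoints join the exceptional set, as the hypothesis speaks of the open
    interval only.\<close>
  then have "negligible (S \<union> {0, L})" by simp
  then show thesis by (rule that) (use S(2) in force)
qed

lemma integral_AE_eq:
  fixes f g :: "real \<Rightarrow> real"
  assumes "AE x in lborel. x \<in> {0<..<L} \<longrightarrow> f x = g x" "x \<in> {0..L}"
  shows "integral {0..x} f = integral {0..x} g"
proof -
  obtain S where "negligible S" "\<And>x. x \<in> {0..L} - S \<Longrightarrow> f x = g x"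
    using AE_interval_negligible[OF assms(1)] by blast
  then show ?thesis using assms(2) by (intro integral_spike) auto
qed

text \<open>Here an almost everywhere sign of an L^1 datum becomes the monotone primitive required
  by the maximum principle. Setting the datum to 0 on the null set makes the sign hold
  everywhere.\<close>

lemma mono_on_integral_AE:
  fixes f :: "real \<Rightarrow> real"
  assumes "AE x in lborel. x \<in> {0<..<L} \<longrightarrow> 0 \<le> f x" and f: "f integrable_on {0..L}"
  shows "mono_on {0..L} (\<lambda>x. integral {0..x} f)"
proof -
  obtain S where S: "negligible S" "\<And>x. x \<in> {0..L} - S \<Longrightarrow> 0 \<le> f x"
    using AE_interval_negligible[OF assms(1)] by blast
  define g where "g x = (if x \<in> S then 0 else f x)" for x
  have g: "g integrable_on {0..L}" using f S(1) by (rule integrable_spike) (auto simp: g_def)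
  have eq: "integral {0..x} f = integral {0..x} g" for x
    using S(1) by (rule integral_spike) (auto simp: g_def)
  show ?thesis
    unfolding eq
  proof (rule mono_onI)
    fix x y assume xy: "x \<in> {0..L}" "y \<in> {0..L}" "x \<le> y"
    show "integral {0..x} g \<le> integral {0..y} g"
      using xy S(2) by (intro integral_subset_le integrable_on_subinterval[OF g]) (auto simp: g_def)
  qed
qed

text \<open>With v' = -y3, integrating the equation once cancels the L^1 part: -y3 plus the
  primitive of the datum is a constant minus the primitive of a continuous function.\<close>

lemma W41_imp_lin_sol:
  assumes L: "0 < L" and W: "W41 L y y1 y2 y3 y4" and bc: "BC L y y2"
    and p: "p integrable_on {0..L}" and g: "continuous_on {0..L} g"
    and eq: "AE x in lborel. x \<in> {0<..<L} \<longrightarrow> y4 x - M * y2 x + N * integral {0..L} y = p x + g x"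
  shows "lin_sol L M N (\<lambda>x. integral {0..x} p + integral {0..x} g) (\<lambda>x. - y2 x)"
    and "\<And>x. x \<in> {0..L} \<Longrightarrow> y x = dirichlet_inv L (\<lambda>x. - y2 x) x"
    and "integral {0..L} y = moment L (\<lambda>x. - y2 x)"
proof -
  have d: "(y has_real_derivative y1 x) (at x within {0..L})"
    "(y1 has_real_derivative - (- y2 x)) (at x within {0..L})"
    "(y2 has_real_derivative y3 x) (at x within {0..L})" if "x \<in> {0..L}" for x
    using W that unfolding W41_def minus_minus by blast+
  have y3: "y3 x = y3 0 + integral {0..x} y4" if "x \<in> {0..L}" for x
    using W that unfolding W41_def by blast
  have cy2: "continuous_on {0..L} y2" using d(3) by (rule DERIV_continuous_on)
  then have cv: "continuous_on {0..L} (\<lambda>x. - y2 x)" by (intro continuous_intros)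
  have ends: "y 0 = 0" "y L = 0" "y2 0 = 0" "y2 L = 0" using bc unfolding BC_def by auto
  show "y x = dirichlet_inv L (\<lambda>x. - y2 x) x" if "x \<in> {0..L}" for x
    by (rule dirichlet_inv_eqI[OF L cv d(1,2) ends(1,2) that])
  show mom: "integral {0..L} y = moment L (\<lambda>x. - y2 x)"
    by (rule integral_eq_moment[OF L cv d(1,2) ends(1,2)])
  let ?c = "N * moment L (\<lambda>x. - y2 x)"
  have int4: "integral {0..x} y4
      = integral {0..x} p + integral {0..x} g + integral {0..x} (\<lambda>s. M * y2 s - ?c)"
    if x: "x \<in> {0..L}" for x
  proof -
    have sub: "{0..x} \<subseteq> {0..L}" using x by auto
    have i: "p integrable_on {0..x}" "g integrable_on {0..x}" "(\<lambda>s. M * y2 s - ?c) integrable_on {0..x}"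
      using continuous_on_subset[OF g sub] continuous_on_subset[OF cy2 sub]
        integrable_on_subinterval[OF p sub]
      by (auto intro!: integrable_continuous_interval continuous_intros)
    have "AE x in lborel. x \<in> {0<..<L} \<longrightarrow> y4 x = p x + g x + (M * y2 x - ?c)"
      using eq by eventually_elim (auto simp: mom algebra_simps)
    then have "integral {0..x} y4 = integral {0..x} (\<lambda>s. p s + g s + (M * y2 s - ?c))"
      using x by (rule integral_AE_eq)
    also have "\<dots> = integral {0..x} (\<lambda>s. p s + g s) + integral {0..x} (\<lambda>s. M * y2 s - ?c)"
      by (intro integral_add integrable_add i)
    also have "integral {0..x} (\<lambda>s. p s + g s) = integral {0..x} p + integral {0..x} g"
      by (intro integral_add i)
    finally show ?thesis .
  qed
  have "((\<lambda>x. - y3 x + (integral {0..x} p + integral {0..x} g)) has_real_derivative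
      M * (- y2 x) + ?c) (at x within {0..L})" if x: "x \<in> {0..L}" for x
  proof (rule has_field_derivative_transform_within[OF _ zero_less_one x])
    have "((\<lambda>x. integral {0..x} (\<lambda>s. M * y2 s - ?c)) has_real_derivative M * y2 x - ?c) (at x within {0..L})"
      using x by (intro integral_has_real_derivative continuous_intros cy2)
    from DERIV_diff[OF DERIV_const[of "- y3 0"] this]
    show "((\<lambda>x. - y3 0 - integral {0..x} (\<lambda>s. M * y2 s - ?c)) has_real_derivative
        M * (- y2 x) + ?c) (at x within {0..L})" by simp
    show "- y3 0 - integral {0..z} (\<lambda>s. M * y2 s - ?c) =
        - y3 z + (integral {0..z} p + integral {0..z} g)" if "z \<in> {0..L}" for z
      using y3[OF that] int4[OF that] by simp
  qed
  then show "lin_sol L M N (\<lambda>x. integral {0..x} p + integral {0..x} g) (\<lambda>x. - y2 x)"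
    unfolding lin_sol_def using ends d(3)
    by (intro conjI exI[of _ "\<lambda>x. - y3 x"] ballI) (auto intro!: DERIV_minus)
qed

text \<open>The fourth derivative is defined by solving the equation for it, so in the applications
  the equation holds at every point.\<close>

lemma lin_sol_imp_W41:
  assumes L: "0 < L" and p: "p absolutely_integrable_on {0..L}" and g: "continuous_on {0..L} g"
    and sol: "lin_sol L M N (\<lambda>x. integral {0..x} p + integral {0..x} g) v"
  obtains y3 where "W41 L (dirichlet_inv L v) (dirichlet_inv1 L v) (\<lambda>x. - v x) y3
      (\<lambda>x. p x + g x - M * v x - N * moment L v)"
    and "BC L (dirichlet_inv L v) (\<lambda>x. - v x)"
proof -
  obtain v1 where v0: "v 0 = 0" "v L = 0"
    and v: "\<And>x. x \<in> {0..L} \<Longrightarrow> (v has_real_derivative v1 x) (at x within {0..L})"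
    and H: "\<And>x. x \<in> {0..L} \<Longrightarrow>
        ((\<lambda>x. v1 x + (integral {0..x} p + integral {0..x} g)) has_real_derivative
          M * v x + N * moment L v) (at x within {0..L})"
    using sol unfolding lin_sol_def by blast
  note cv = lin_sol_continuous[OF sol]
  let ?y4 = "\<lambda>x. p x + g x - M * v x - N * moment L v"
  have p': "p integrable_on {0..L}" using p by (simp add: absolutely_integrable_on_def)
  have y3: "- v1 x = - v1 0 + integral {0..x} ?y4" if x: "x \<in> {0..L}" for x
  proof -
    have sub: "{0..x} \<subseteq> {0..L}" using x by auto
    have i: "(p has_integral integral {0..x} p) {0..x}" "(g has_integral integral {0..x} g) {0..x}"
      using continuous_on_subset[OF g sub] integrable_on_subinterval[OF p' sub]
      by (auto intro!: integrable_continuous_interval)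
    have "((\<lambda>x. M * v x + N * moment L v) has_integral
        ((v1 x + (integral {0..x} p + integral {0..x} g)) - (v1 0 + (integral {0..0} p + integral {0..0} g)))) {0..x}"
      using x by (intro has_integral_real_derivative DERIV_subset[OF H]) auto
    from has_integral_diff[OF has_integral_add[OF i] this]
    have "((\<lambda>s. p s + g s - (M * v s + N * moment L v)) has_integral (v1 0 - v1 x)) {0..x}"
      by (simp add: algebra_simps)
    then have "(?y4 has_integral (v1 0 - v1 x)) {0..x}"
      by (simp add: algebra_simps)
    then show ?thesis by (simp add: integral_unique)
  qed
  have "?y4 absolutely_integrable_on {0..L}"
  proof -
    have "(\<lambda>x. g x - M * v x - N * moment L v) absolutely_integrable_on {0..L}"
      by (intro absolutely_integrable_continuous_real continuous_intros g cv)
    from set_integral_add(1)[OF p this] show ?thesis by (simp add: algebra_simps)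
  qed
  then have "W41 L (dirichlet_inv L v) (dirichlet_inv1 L v) (\<lambda>x. - v x) (\<lambda>x. - v1 x) ?y4"
    unfolding W41_def using L
    by (intro conjI ballI dirichlet_inv_deriv[OF _ cv] DERIV_minus v y3) auto
  moreover have "BC L (dirichlet_inv L v) (\<lambda>x. - v x)"
    by (simp add: BC_def v0)
  ultimately show thesis by (rule that)
qed

lemma derivs_cong_interval:
  fixes y z :: "real \<Rightarrow> real"
  assumes L: "0 < L" and eq: "\<And>x. x \<in> {0..L} \<Longrightarrow> y x = z x"
    and y: "\<And>x. x \<in> {0..L} \<Longrightarrow> (y has_real_derivative y1 x) (at x within {0..L})"
    and z: "\<And>x. x \<in> {0..L} \<Longrightarrow> (z has_real_derivative z1 x) (at x within {0..L})"
    and x: "x \<in> {0..L}"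
  shows "y1 x = z1 x"
proof (rule vector_derivative_unique_within_closed_interval[of 0 L x z])
  have "(z has_real_derivative y1 x) (at x within {0..L})"
    using y[OF x] eq by (rule has_field_derivative_transform_within[OF _ zero_less_one x])
  then show "(z has_vector_derivative y1 x) (at x within cbox 0 L)"
    by (simp add: has_real_derivative_iff_has_vector_derivative)
  show "(z has_vector_derivative z1 x) (at x within cbox 0 L)"
    using z[OF x] by (simp add: has_real_derivative_iff_has_vector_derivative)
qed (use L x in auto)

text \<open>\<open>in_S\<close> and \<open>iter_step\<close> bind their derivatives existentially,
  so any witness for the second derivative must be identified with -v.\<close>

lemma dirichlet_inv_second_deriv_unique:
  assumes L: "0 < L" and v: "continuous_on {0..L} v"
    and eq: "\<And>x. x \<in> {0..L} \<Longrightarrow> y x = dirichlet_inv L v x"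
    and y: "\<And>x. x \<in> {0..L} \<Longrightarrow> (y has_real_derivative y1 x) (at x within {0..L})"
    and y1: "\<And>x. x \<in> {0..L} \<Longrightarrow> (y1 has_real_derivative y2 x) (at x within {0..L})"
    and x: "x \<in> {0..L}"
  shows "y2 x = - v x"
proof -
  have L0: "L \<noteq> 0" using L by simp
  note d = dirichlet_inv_deriv[OF L0 v]
  have "y1 x = dirichlet_inv1 L v x" if "x \<in> {0..L}" for x
    using derivs_cong_interval[OF L eq y d(1) that] .
  then show ?thesis using derivs_cong_interval[OF L _ y1 d(2) x] by blast
qed

section \<open>Monotone iteration\<close>

locale plate_problem =
  fixes L a b c lam :: real and p :: "real \<Rightarrow> real"
  assumes L: "L > 0" and a: "a > 0" and b: "b > 0" and c: "c > 0"
    and p_int: "p absolutely_integrable_on {0..L}"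
    and p_nonneg: "AE x in lborel. x \<in> {0<..<L} \<longrightarrow> 0 \<le> p x"
    and lam: "lam > 0"
    and hp: "AE x in lborel. x \<in> {0<..<L} \<longrightarrow>
       p x \<le> (lam * pi ^ 4 / L ^ 4 + a * lam * pi ^ 2 / L ^ 2 + 2 * b * lam ^ 2 * pi / L)
                * sin (pi / L * x) + 2 * lam * c * L / pi"
    and hN: "c + b * lam * pi ^ 2 / L ^ 2
       \<le> 4 * (a + 2 * b * lam * L / pi) / L ^ 3
           * sigma_fn (sqrt (a + 2 * b * lam * L / pi) * L)"
begin

definition M where "M = a + 2 * b * lam * L / pi"
definition N where "N = c + b * lam * pi ^ 2 / L ^ 2"
text \<open>\<open>k1\<close> is b times the integral of \<open>beta\<close>, and \<open>k2\<close>
  is b times the maximum of \<open>beta_curv\<close>. These are the amounts by which M exceeds a and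
  N exceeds c.\<close>

definition k1 where "k1 = 2 * b * lam * (L / pi)"
definition k2 where "k2 = b * lam * (pi ^ 2 / L ^ 2)"

lemma M_eq: "M = a + k1" and N_eq: "N = c + k2"
  by (auto simp: M_def N_def k1_def k2_def)

lemma k_pos: "0 < k1" "0 < k2"
  using b lam L by (auto simp: k1_def k2_def)

sublocale lin: nonlocal_plate L M N "sqrt M"
proof
  show "0 < sqrt M" "(sqrt M)\<^sup>2 = M" "0 < N"
    using a c k_pos by (auto simp: M_eq N_eq)
  show "N \<le> 4 * M / L ^ 3 * sigma_fn (sqrt M * L)"
    using hN by (simp add: M_def N_def)
qed (rule L)

section \<open>The upper solution and the fixed point form of (P)\<close>

definition beta where "beta x = lam * sin (pi / L * x)"
definition beta_curv where "beta_curv x = lam * (pi / L) ^ 2 * sin (pi / L * x)"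
definition upper_rhs where
  "upper_rhs x = (lam * pi ^ 4 / L ^ 4 + a * lam * pi ^ 2 / L ^ 2 + 2 * b * lam ^ 2 * pi / L)
     * sin (pi / L * x) + 2 * lam * c * L / pi"

text \<open>Here $u = -y_{n-1}''$, and the term $p$ of the iteration is added only in the primitive.\<close>

definition rhs where "rhs u x = (k1 - b * moment L u) * u x + k2 * moment L u"
definition rhs_prim where "rhs_prim u x = integral {0..x} p + integral {0..x} (rhs u)"

lemma p_integrable: "p integrable_on {0..L}"
  using p_int by (simp add: absolutely_integrable_on_def)

lemma continuous_rhs: "continuous_on {0..L} u \<Longrightarrow> continuous_on {0..L} (rhs u)"
  unfolding rhs_def by (intro continuous_intros)

lemma continuous_rhs_prim: "u integrable_on {0..L} \<Longrightarrow> continuous_on {0..L} (rhs_prim u)"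
  unfolding rhs_prim_def rhs_def
  by (intro continuous_intros indefinite_integral_continuous_1 p_integrable integrable_add
      integrable_on_mult_right) auto

lemma beta_derivs:
  "(beta has_real_derivative lam * (pi / L) * cos (pi / L * x)) (at x within A)"
  "((\<lambda>x. lam * (pi / L) * cos (pi / L * x)) has_real_derivative - beta_curv x) (at x within A)"
  "((\<lambda>x. - beta_curv x) has_real_derivative - lam * (pi / L) ^ 3 * cos (pi / L * x)) (at x within A)"
  "((\<lambda>x. - lam * (pi / L) ^ 3 * cos (pi / L * x)) has_real_derivative
      lam * (pi / L) ^ 4 * sin (pi / L * x)) (at x within A)"
  using L unfolding beta_def[abs_def] beta_curv_def[abs_def]
  by (auto intro!: derivative_eq_intros simp: power2_eq_square power3_eq_cube power4_eq_xxxx field_simps)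

lemma beta_ends: "beta 0 = 0" "beta L = 0" "beta_curv 0 = 0" "beta_curv L = 0"
  using L by (auto simp: beta_def beta_curv_def)

lemma continuous_beta_curv: "continuous_on A beta_curv"
  unfolding beta_curv_def by (intro continuous_intros)

lemma beta_curv_nonneg: "0 \<le> beta_curv x" and beta_curv_le: "beta_curv x \<le> lam * (pi / L)\<^sup>2"
  if "x \<in> {0..L}"
proof -
  have "0 \<le> sin (pi / L * x)"
    using that L by (intro sin_ge_zero) (auto simp: field_simps)
  then show "0 \<le> beta_curv x" using lam by (simp add: beta_curv_def)
  have "lam * (pi / L)\<^sup>2 * sin (pi / L * x) \<le> lam * (pi / L)\<^sup>2 * 1"
    using lam by (intro mult_left_mono) auto
  then show "beta_curv x \<le> lam * (pi / L)\<^sup>2" by (simp add: beta_curv_def)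
qed

lemma beta_eq: "x \<in> {0..L} \<Longrightarrow> beta x = dirichlet_inv L beta_curv x"
  by (rule dirichlet_inv_eqI[OF L continuous_beta_curv beta_derivs(1,2)]) (auto simp: beta_ends)

lemma integral_beta: "integral {0..L} beta = 2 * lam * L / pi"
proof -
  have "(beta has_integral (- lam * L / pi * cos (pi / L * L) - (- lam * L / pi * cos (pi / L * 0)))) {0..L}"
    by (rule has_integral_real_derivative)
       (use L in \<open>auto intro!: derivative_eq_intros simp: beta_def field_simps\<close>)
  then show ?thesis using L by (simp add: integral_unique)
qed

lemma integral_beta_moment: "integral {0..L} beta = moment L beta_curv"
  by (rule integral_eq_moment[OF L continuous_beta_curv beta_derivs(1,2)]) (auto simp: beta_ends)

lemma b_moment_beta_curv: "b * moment L beta_curv = k1"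
  by (simp add: integral_beta_moment[symmetric] integral_beta k1_def)

lemma W41_beta: "W41 L beta (\<lambda>x. lam * (pi / L) * cos (pi / L * x)) (\<lambda>x. - beta_curv x)
    (\<lambda>x. - lam * (pi / L) ^ 3 * cos (pi / L * x)) (\<lambda>x. lam * (pi / L) ^ 4 * sin (pi / L * x))"
  (is "W41 L beta ?y1 ?y2 ?y3 ?y4")
proof -
  have y3: "?y3 x = ?y3 0 + integral {0..x} ?y4" if "x \<in> {0..L}" for x
  proof -
    have "(?y4 has_integral (?y3 x - ?y3 0)) {0..x}"
      using that by (intro has_integral_real_derivative beta_derivs) auto
    from integral_unique[OF this] show ?thesis by linarith
  qed
  show ?thesis
    unfolding W41_def
    by (intro conjI ballI beta_derivs y3 absolutely_integrable_continuous_real continuous_intros)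
qed

lemma BC_beta: "BC L beta (\<lambda>x. - beta_curv x)"
  by (simp add: BC_def beta_ends)

text \<open>This is the origin of the bound on p: it says precisely that p stays below the operator
  of (P) applied to \<open>beta\<close>.\<close>

lemma P_lhs_beta:
  "P_lhs L a b c beta (\<lambda>x. - beta_curv x) (\<lambda>x. lam * (pi / L) ^ 4 * sin (pi / L * x)) x = upper_rhs x"
  unfolding P_lhs_def integral_beta beta_curv_def upper_rhs_def using L
  by (simp add: field_simps power2_eq_square power4_eq_xxxx)

text \<open>Adding \<open>k1 * v x + k2 * moment L v\<close> to both sides makes the left side
  linear, so solutions of (P) are the fixed points of the iteration.\<close>

lemma P_lhs_eq_iff:
  assumes "integral {0..L} y = moment L v"
  shows "P_lhs L a b c y (\<lambda>x. - v x) y4 x = q \<longleftrightarrow>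
    y4 x - M * - v x + N * integral {0..L} y = q + rhs v x"
  using assms by (auto simp: P_lhs_def M_eq N_eq rhs_def algebra_simps)

lemma lower_solution: "is_lower_solution L a b c p (\<lambda>x. 0)"
  unfolding is_lower_solution_def
proof (intro exI conjI)
  show "W41 L (\<lambda>x. 0) (\<lambda>x. 0) (\<lambda>x. 0) (\<lambda>x. 0) (\<lambda>x. 0)"
    by (auto simp: W41_def)
  show "AE x in lborel. x \<in> {0<..<L} \<longrightarrow> P_lhs L a b c (\<lambda>x. 0) (\<lambda>x. 0) (\<lambda>x. 0) x \<le> p x"
    using p_nonneg by (simp add: P_lhs_def)
qed (simp add: BC_def)

lemma upper_solution: "is_upper_solution L a b c p beta"
  unfolding is_upper_solution_def
proof (intro exI conjI)
  show "AE x in lborel. x \<in> {0<..<L} \<longrightarrow> P_lhs L a b c beta (\<lambda>x. - beta_curv x)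
      (\<lambda>x. lam * (pi / L) ^ 4 * sin (pi / L * x)) x \<ge> p x"
    using hp unfolding P_lhs_beta upper_rhs_def .
qed (rule W41_beta BC_beta)+

text \<open>\<open>beta\<close> solves (P) exactly with \<open>upper_rhs\<close> in place of p, so
  being an upper solution reduces to comparing two solutions.\<close>

lemma beta_lin_sol:
  "lin_sol L M N (\<lambda>x. integral {0..x} upper_rhs + integral {0..x} (rhs beta_curv)) beta_curv"
proof -
  have "continuous_on {0..L} upper_rhs" unfolding upper_rhs_def by (intro continuous_intros)
  then have "upper_rhs integrable_on {0..L}" by (rule integrable_continuous_interval)
  then have "lin_sol L M N (\<lambda>x. integral {0..x} upper_rhs + integral {0..x} (rhs beta_curv))
      (\<lambda>x. - (- beta_curv x))"
    using P_lhs_eq_iff[OF integral_beta_moment] P_lhs_beta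
    by (intro W41_imp_lin_sol(1)[OF L W41_beta BC_beta _ continuous_rhs[OF continuous_beta_curv]]) auto
  then show ?thesis by simp
qed

section \<open>The order interval and the monotone step map\<close>

text \<open>The condition of \<open>in_S\<close> on -u''. The bounds on the function itself follow
  by positivity of the Green operator.\<close>

definition box where
  "box u \<longleftrightarrow> continuous_on {0..L} u \<and> (\<forall>x\<in>{0..L}. 0 \<le> u x \<and> u x \<le> beta_curv x)"

lemma box_D:
  assumes "box u"
  shows "continuous_on {0..L} u" "x \<in> {0..L} \<Longrightarrow> 0 \<le> u x" "x \<in> {0..L} \<Longrightarrow> u x \<le> beta_curv x"
    "x \<in> {0..L} \<Longrightarrow> \<bar>u x\<bar> \<le> lam * (pi / L)\<^sup>2"
proof -
  show "continuous_on {0..L} u" using assms by (simp add: box_def)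
  show *: "x \<in> {0..L} \<Longrightarrow> 0 \<le> u x" "x \<in> {0..L} \<Longrightarrow> u x \<le> beta_curv x"
    using assms by (auto simp: box_def)
  show "x \<in> {0..L} \<Longrightarrow> \<bar>u x\<bar> \<le> lam * (pi / L)\<^sup>2"
    using * beta_curv_le[of x] by linarith
qed

lemma box_moment:
  assumes "box u"
  shows "0 \<le> moment L u" "b * moment L u \<le> k1"
proof -
  show "0 \<le> moment L u" using box_D[OF assms] by (intro moment_nonneg) auto
  have "moment L u \<le> moment L beta_curv"
    using box_D[OF assms] by (intro moment_mono continuous_beta_curv) auto
  then show "b * moment L u \<le> k1"
    using b by (simp add: b_moment_beta_curv[symmetric])
qed

lemma box_0: "box (\<lambda>x. 0)"
  using beta_curv_nonneg by (simp add: box_def)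

lemma box_beta_curv: "box beta_curv"
  using beta_curv_nonneg continuous_beta_curv by (simp add: box_def)

text \<open>The difference splits into two products. Their signs need b \<open>moment L w\<close>
  \<le> \<open>k1\<close> and b u \<le> \<open>k2\<close>, which the box guarantees by the choice of
  \<open>k1\<close> and \<open>k2\<close>.\<close>

lemma rhs_mono:
  assumes u: "box u" and w: "box w" and le: "\<And>x. x \<in> {0..L} \<Longrightarrow> u x \<le> w x" and x: "x \<in> {0..L}"
  shows "rhs u x \<le> rhs w x"
proof -
  have "rhs w x - rhs u x
      = (k1 - b * moment L w) * (w x - u x) + (moment L w - moment L u) * (k2 - b * u x)"
    by (simp add: rhs_def algebra_simps)
  moreover have "0 \<le> (k1 - b * moment L w) * (w x - u x)"
    using box_moment[OF w] le[OF x] by (intro mult_nonneg_nonneg) auto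
  moreover have "0 \<le> (moment L w - moment L u) * (k2 - b * u x)"
  proof (intro mult_nonneg_nonneg)
    show "0 \<le> moment L w - moment L u"
      using moment_mono[OF box_D(1)[OF u] box_D(1)[OF w] le] by simp
    have "b * u x \<le> b * (lam * (pi / L)\<^sup>2)"
      using box_D(4)[OF u x] b by (intro mult_left_mono) auto
    then show "0 \<le> k2 - b * u x" by (simp add: k2_def power_divide mult.assoc)
  qed
  ultimately show ?thesis by linarith
qed

lemma mono_on_integral_diff:
  fixes f g :: "real \<Rightarrow> real"
  assumes "continuous_on {0..L} f" "continuous_on {0..L} g" "\<And>x. x \<in> {0..L} \<Longrightarrow> g x \<le> f x"
  shows "mono_on {0..L} (\<lambda>x. integral {0..x} f - integral {0..x} g)"
proof -
  have "mono_on {0..L} (\<lambda>x. integral {0..x} (\<lambda>s. f s - g s))"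
    using assms by (intro mono_on_integral_AE integrable_continuous_interval continuous_intros) auto
  moreover have "integral {0..x} (\<lambda>s. f s - g s) = integral {0..x} f - integral {0..x} g"
    if "x \<in> {0..L}" for x
    using that assms(1,2)
    by (intro integral_diff integrable_continuous_interval) (auto intro: continuous_on_subset)
  ultimately show ?thesis by (simp add: mono_on_def)
qed

text \<open>The primitive of p cancels in the difference of the data, leaving continuous functions
  ordered by \<open>rhs_mono\<close>.\<close>

lemma box_comparison:
  assumes "box u" "box w" "\<And>x. x \<in> {0..L} \<Longrightarrow> u x \<le> w x"
    and "lin_sol L M N (rhs_prim u) v" "lin_sol L M N (rhs_prim w) z" "x \<in> {0..L}"
  shows "v x \<le> z x"
proof (rule lin.comparison[OF assms(4,5) _ assms(6)])
  show "mono_on {0..L} (\<lambda>x. rhs_prim w x - rhs_prim u x)"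
    using mono_on_integral_diff[OF continuous_rhs continuous_rhs rhs_mono[OF assms(1-3)]]
      box_D(1) assms by (simp add: rhs_prim_def)
qed

text \<open>The choice is determined on [0,L] by uniqueness and arbitrary outside, which is why all
  later identifications are restricted to that interval.\<close>

definition step where "step u = (SOME v. lin_sol L M N (rhs_prim u) v)"

lemma step:
  assumes "continuous_on {0..L} u"
  shows "lin_sol L M N (rhs_prim u) (step u)"
  unfolding step_def using assms
  by (rule someI_ex[OF lin.lin_sol_exists[OF continuous_rhs_prim[OF integrable_continuous_interval]]])

lemma step_0_nonneg:
  assumes "x \<in> {0..L}"
  shows "0 \<le> step (\<lambda>x. 0) x"
proof (rule lin.maximum_principle[OF step _ assms])
  have "rhs_prim (\<lambda>x. 0) = (\<lambda>x. integral {0..x} p)"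
    by (rule ext) (simp add: rhs_prim_def rhs_def[abs_def] moment_def)
  then show "mono_on {0..L} (rhs_prim (\<lambda>x. 0))"
    using mono_on_integral_AE[OF p_nonneg p_integrable] by simp
qed auto

text \<open>Both problems carry the datum \<open>rhs beta_curv\<close>, so the primitives differ by
  that of \<open>upper_rhs - p\<close>, which is monotone by the bound on p.\<close>

lemma step_beta_curv_le:
  assumes "x \<in> {0..L}"
  shows "step beta_curv x \<le> beta_curv x"
proof (rule lin.comparison[OF step[OF continuous_beta_curv] beta_lin_sol _ assms])
  have up: "upper_rhs integrable_on {0..L}"
    unfolding upper_rhs_def by (intro integrable_continuous_interval continuous_intros)
  have "mono_on {0..L} (\<lambda>x. integral {0..x} (\<lambda>s. upper_rhs s - p s))"
    using hp by (intro mono_on_integral_AE integrable_diff up p_integrable) (simp add: upper_rhs_def)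
  moreover have "integral {0..x} (\<lambda>s. upper_rhs s - p s) = integral {0..x} upper_rhs - integral {0..x} p"
    if "x \<in> {0..L}" for x
    using that by (intro integral_diff integrable_on_subinterval[OF up]
        integrable_on_subinterval[OF p_integrable]) auto
  ultimately show "mono_on {0..L} (\<lambda>x. integral {0..x} upper_rhs + integral {0..x} (rhs beta_curv)
      - rhs_prim beta_curv x)"
    by (simp add: mono_on_def rhs_prim_def)
qed

lemma box_step:
  assumes "box u"
  shows "box (step u)"
proof -
  note s = step[OF box_D(1)[OF assms]]
  have "0 \<le> step u x" "step u x \<le> beta_curv x" if x: "x \<in> {0..L}" for x
  proof -
    have "step (\<lambda>x. 0) x \<le> step u x"
      using box_D[OF assms] by (intro box_comparison[OF box_0 assms _ step s x]) auto
    then show "0 \<le> step u x" using step_0_nonneg[OF x] by linarith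
    have "step u x \<le> step beta_curv x"
      using box_D[OF assms]
      by (intro box_comparison[OF assms box_beta_curv _ s step[OF continuous_beta_curv] x]) auto
    then show "step u x \<le> beta_curv x" using step_beta_curv_le[OF x] by linarith
  qed
  then show ?thesis unfolding box_def using lin_sol_continuous[OF s] by auto
qed

lemma box_funpow_step: "box u \<Longrightarrow> box ((step ^^ n) u)"
  by (induction n) (auto intro: box_step)

lemma step_mono:
  assumes "box u" "box w" "\<And>x. x \<in> {0..L} \<Longrightarrow> u x \<le> w x" "x \<in> {0..L}"
  shows "step u x \<le> step w x"
  using box_comparison[OF assms(1-3) step[OF box_D(1)[OF assms(1)]] step[OF box_D(1)[OF assms(2)]] assms(4)] .

lemma step_limit:
  assumes box: "\<And>n. box (u n)" and u: "\<And>n. u (Suc n) = step (u n)"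
    and lim: "\<And>x. x \<in> {0..L} \<Longrightarrow> (\<lambda>n. u n x) \<longlonglongrightarrow> w x"
  shows "lin_sol L M N (rhs_prim w) w" "box w"
    "uniform_limit {0..L} (\<lambda>n. dirichlet_inv L (u n)) (dirichlet_inv L w) sequentially"
proof -
  let ?C = "lam * (pi / L)\<^sup>2"
  note cu = box_D(1)[OF box] and uB = box_D(4)[OF box]
  have mom: "(\<lambda>n. moment L (u n)) \<longlonglongrightarrow> moment L w"
    using L cu uB lim by (rule moment_tendsto)
  have wint: "w integrable_on {0..L}"
    using bounded_pointwise_integral(1)[OF cu uB lim] by simp
  \<comment> \<open>A bound for \<open>rhs\<close> over the whole box: the coefficient of u lies
    between 0 and \<open>k1\<close>, and the moment is at most \<open>k1 / b\<close>.\<close>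
  define K where "K = k1 * ?C + k2 * (k1 / b)"
  have rhsB: "\<bar>rhs (u n) x\<bar> \<le> K" if x: "x \<in> {0..L}" for n x
  proof -
    note bm = box_moment[OF box[of n]]
    have "moment L (u n) \<le> k1 / b" using bm b by (simp add: field_simps)
    then have "k2 * moment L (u n) \<le> k2 * (k1 / b)"
      using k_pos by (intro mult_left_mono) auto
    moreover have "0 \<le> k2 * moment L (u n)"
      using bm k_pos by simp
    moreover have "(k1 - b * moment L (u n)) * u n x \<le> k1 * ?C"
      using bm b k_pos uB[OF x, of n] box_D(2)[OF box x] by (intro mult_mono) auto
    moreover have "0 \<le> (k1 - b * moment L (u n)) * u n x"
      using bm box_D(2)[OF box x] by (intro mult_nonneg_nonneg) auto
    ultimately show ?thesis unfolding rhs_def K_def by linarith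
  qed
  have rlim: "(\<lambda>n. rhs (u n) x) \<longlonglongrightarrow> rhs w x" if "x \<in> {0..L}" for x
    unfolding rhs_def by (intro tendsto_intros mom lim that)
  have K0: "0 \<le> K" using rhsB[of 0 0] L by auto
  have cP: "continuous_on {0..L} (\<lambda>x. integral {0..x} p)"
    by (rule indefinite_integral_continuous_1[OF p_integrable])
  obtain B where "\<forall>y\<in>(\<lambda>x. integral {0..x} p) ` {0..L}. norm y \<le> B"
    using compact_imp_bounded[OF compact_continuous_image[OF cP compact_Icc]]
    unfolding bounded_iff by blast
  then have B: "\<bar>integral {0..x} p\<bar> \<le> B" if "x \<in> {0..L}" for x
    using that by simp
  show "lin_sol L M N (rhs_prim w) w"
  \<comment> \<open>The data come from \<open>u n\<close> and the solutions are
    \<open>u (Suc n)\<close>; both sequences have the limit w, which makes w a fixed point.\<close>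
  proof (rule lin_sol_limit[OF L, where F = "\<lambda>n. rhs_prim (u n)" and v = "\<lambda>n. u (Suc n)"
        and B = "B + K * L" and C = ?C])
    show "lin_sol L M N (rhs_prim (u n)) (u (Suc n))" for n
      unfolding u by (rule step[OF cu])
    show "continuous_on {0..L} (rhs_prim (u n))" for n
      by (intro continuous_rhs_prim integrable_continuous_interval cu)
    show "rhs_prim (u n) 0 = 0" for n by (simp add: rhs_prim_def)
    show "continuous_on {0..L} (rhs_prim w)" by (rule continuous_rhs_prim[OF wint])
    show "(\<lambda>n. rhs_prim (u n) x) \<longlonglongrightarrow> rhs_prim w x" if x: "x \<in> {0..L}" for x
      unfolding rhs_prim_def
    proof (intro tendsto_add tendsto_const bounded_pointwise_integral(2))
      show "continuous_on {0..x} (rhs (u n))" for n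
        using continuous_on_subset[OF continuous_rhs[OF cu]] x by auto
      show "\<bar>rhs (u n) s\<bar> \<le> K" "(\<lambda>n. rhs (u n) s) \<longlonglongrightarrow> rhs w s" if "s \<in> {0..x}" for n s
        using rhsB rlim that x by auto
    qed
    show "\<bar>rhs_prim (u n) x\<bar> \<le> B + K * L" if x: "x \<in> {0..L}" for n x
    proof -
      have "continuous_on {0..x} (rhs (u n))"
        using continuous_on_subset[OF continuous_rhs[OF cu]] x by auto
      then have "norm (integral {0..x} (rhs (u n))) \<le> K * (x - 0)"
        using x rhsB by (intro integral_bound) auto
      also have "\<dots> \<le> K * L" using x K0 by (auto intro!: mult_left_mono)
      finally show ?thesis using B[OF x] unfolding rhs_prim_def by simp
    qed
    show "(\<lambda>n. u (Suc n) x) \<longlonglongrightarrow> w x" if "x \<in> {0..L}" for x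
      using lim[OF that] by (rule LIMSEQ_Suc)
  qed (rule uB)
  \<comment> \<open>Continuity of the pointwise limit comes from the equation, and membership in the
    box depends on it.\<close>
  then have cw: "continuous_on {0..L} w" by (rule lin_sol_continuous)
  have "0 \<le> w x" "w x \<le> beta_curv x" if "x \<in> {0..L}" for x
    using lim[OF that] box_D(2,3)[OF box that]
    by (auto intro: LIMSEQ_le_const LIMSEQ_le_const2)
  then show "box w" using cw by (auto simp: box_def)
  show "uniform_limit {0..L} (\<lambda>n. dirichlet_inv L (u n)) (dirichlet_inv L w) sequentially"
    by (rule dirichlet_inv_uniform_limit[OF L cu cw uB lim])
qed

section \<open>Solutions of (P) as fixed points of the step map\<close>

lemma solution_imp_fixed:
  assumes "is_solution L a b c p y"
  obtains v where "lin_sol L M N (rhs_prim v) v" "\<And>x. x \<in> {0..L} \<Longrightarrow> y x = dirichlet_inv L v x"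
proof -
  obtain y1 y2 y3 y4 where W: "W41 L y y1 y2 y3 y4" and bc: "BC L y y2"
    and eq: "AE x in lborel. x \<in> {0<..<L} \<longrightarrow> P_lhs L a b c y y2 y4 x = p x"
    using assms unfolding is_solution_def by blast
  have y: "(y has_real_derivative y1 x) (at x within {0..L})"
    "(y1 has_real_derivative y2 x) (at x within {0..L})"
    "(y2 has_real_derivative y3 x) (at x within {0..L})" if "x \<in> {0..L}" for x
    using W that unfolding W41_def by blast+
  define v where "v x = - y2 x" for x
  have y2: "y2 = (\<lambda>x. - v x)" by (simp add: v_def)
  have cv: "continuous_on {0..L} v"
    unfolding v_def by (intro continuous_intros DERIV_continuous_on[OF y(3)])
  have mom: "integral {0..L} y = moment L v"
    by (rule integral_eq_moment[OF L cv y(1,2)[unfolded y2]]) (use bc in \<open>auto simp: BC_def\<close>)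
  have "AE x in lborel. x \<in> {0<..<L} \<longrightarrow> y4 x - M * y2 x + N * integral {0..L} y = p x + rhs v x"
    using eq unfolding y2 P_lhs_eq_iff[OF mom] .
  note lin = W41_imp_lin_sol[OF L W bc p_integrable continuous_rhs[OF cv] this]
  show thesis
    by (rule that[of v]) (use lin(1,2) in \<open>auto simp: y2 rhs_prim_def[abs_def]\<close>)
qed

lemma fixed_imp_solution:
  assumes sol: "lin_sol L M N (rhs_prim v) v"
  shows "is_solution L a b c p (dirichlet_inv L v)"
proof -
  note cv = lin_sol_continuous[OF sol]
  obtain y3 where W: "W41 L (dirichlet_inv L v) (dirichlet_inv1 L v) (\<lambda>x. - v x) y3
      (\<lambda>x. p x + rhs v x - M * v x - N * moment L v)"
    and bc: "BC L (dirichlet_inv L v) (\<lambda>x. - v x)"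
    using lin_sol_imp_W41[OF L p_int continuous_rhs[OF cv]] sol
    unfolding rhs_prim_def[abs_def] by blast
  have "P_lhs L a b c (dirichlet_inv L v) (\<lambda>x. - v x)
      (\<lambda>x. p x + rhs v x - M * v x - N * moment L v) x = p x" for x
    unfolding P_lhs_eq_iff[OF integral_dirichlet_inv[OF L cv]]
    by (simp add: integral_dirichlet_inv[OF L cv])
  then show ?thesis unfolding is_solution_def using W bc by blast
qed

lemma box_imp_in_S:
  assumes "box v"
  shows "in_S L lam (dirichlet_inv L v)"
  unfolding in_S_def
proof (rule exI[of _ "dirichlet_inv1 L v"], rule exI[of _ "\<lambda>x. - v x"], intro conjI ballI)
  fix x assume x: "x \<in> {0..L}"
  note cv = box_D(1)[OF assms]
  show "(dirichlet_inv L v has_real_derivative dirichlet_inv1 L v x) (at x within {0..L})"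
    "(dirichlet_inv1 L v has_real_derivative - v x) (at x within {0..L})"
    using dirichlet_inv_deriv[OF _ cv x] L by auto
  have "dirichlet_inv L (\<lambda>x. 0) x \<le> dirichlet_inv L v x"
    using box_D[OF assms] by (intro dirichlet_inv_mono[OF L _ cv _ x]) auto
  then show "0 \<le> dirichlet_inv L v x" by (simp add: dirichlet_inv_def)
  have "dirichlet_inv L v x \<le> dirichlet_inv L beta_curv x"
    using box_D[OF assms] by (intro dirichlet_inv_mono[OF L cv continuous_beta_curv _ x]) auto
  then show "dirichlet_inv L v x \<le> lam * sin (pi / L * x)"
    using beta_eq[OF x] by (simp add: beta_def)
  show "- v x \<le> 0" "- lam * (pi / L)\<^sup>2 * sin (pi / L * x) \<le> - v x"
    using box_D(2,3)[OF assms x] by (auto simp: beta_curv_def)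
qed (use box_D(1)[OF assms] in \<open>auto intro: continuous_intros\<close>)

lemma in_S_imp_box:
  assumes "in_S L lam y" "continuous_on {0..L} v" "\<And>x. x \<in> {0..L} \<Longrightarrow> y x = dirichlet_inv L v x"
  shows "box v"
proof -
  obtain u1 u2 where u: "\<And>x. x \<in> {0..L} \<Longrightarrow> (y has_real_derivative u1 x) (at x within {0..L})"
    "\<And>x. x \<in> {0..L} \<Longrightarrow> (u1 has_real_derivative u2 x) (at x within {0..L})"
    and le: "\<And>x. x \<in> {0..L} \<Longrightarrow> u2 x \<le> 0 \<and> - lam * (pi / L)\<^sup>2 * sin (pi / L * x) \<le> u2 x"
    using assms(1) unfolding in_S_def by blast
  have "u2 x = - v x" if "x \<in> {0..L}" for x
    by (rule dirichlet_inv_second_deriv_unique[OF L assms(2,3) u that])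
  then show ?thesis using le assms(2) by (fastforce simp: box_def beta_curv_def)
qed

section \<open>The iteration in terms of the step map\<close>

text \<open>Uniqueness for the linear problem forces the next iterate, so convergence can be claimed
  for every sequence satisfying the iteration.\<close>

lemma iter_step_step:
  assumes u: "continuous_on {0..L} u" and z: "\<And>x. x \<in> {0..L} \<Longrightarrow> z x = dirichlet_inv L u x"
    and it: "iter_step L a b c lam p z y" and x: "x \<in> {0..L}"
  shows "y x = dirichlet_inv L (step u) x"
proof -
  obtain y1 y2 y3 y4 z1 z2 z3 z4 where W: "W41 L y y1 y2 y3 y4" and bc: "BC L y y2"
    and Wz: "W41 L z z1 z2 z3 z4"
    and eq: "AE x in lborel. x \<in> {0<..<L} \<longrightarrow>
           y4 x - M * y2 x + N * integral {0..L} y =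
           p x + b * z2 x * integral {0..L} z - k1 * z2 x + k2 * integral {0..L} z"
    using it unfolding iter_step_def Let_def M_def[symmetric] N_def[symmetric]
      k1_def[symmetric] k2_def[symmetric] by blast
  have z2: "z2 x = - u x" if "x \<in> {0..L}" for x
    using Wz unfolding W41_def by (intro dirichlet_inv_second_deriv_unique[OF L u z _ _ that]) blast+
  have "integral {0..L} z = integral {0..L} (dirichlet_inv L u)"
    by (rule integral_cong[OF z])
  then have mom: "integral {0..L} z = moment L u"
    by (simp add: integral_dirichlet_inv[OF L u])
  have "AE x in lborel. x \<in> {0<..<L} \<longrightarrow> y4 x - M * y2 x + N * integral {0..L} y = p x + rhs u x"
    using eq by eventually_elim (auto simp: z2 mom rhs_def algebra_simps)
  note lin = W41_imp_lin_sol[OF L W bc p_integrable continuous_rhs[OF u] this]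
  have eq2: "step u s = - y2 s" if "s \<in> {0..L}" for s
    by (rule lin.lin_sol_unique[OF step[OF u] lin(1) _ that]) (simp add: rhs_prim_def)
  show ?thesis
  proof (rule order.antisym)
    show "y x \<le> dirichlet_inv L (step u) x" "dirichlet_inv L (step u) x \<le> y x"
      unfolding lin(2)[OF x]
      using lin_sol_continuous[OF lin(1)] lin_sol_continuous[OF step[OF u]] eq2
      by (auto intro!: dirichlet_inv_mono[OF L _ _ _ x])
  qed
qed

lemma iter_step_exists:
  assumes u: "continuous_on {0..L} u" and z: "W41 L z z1 (\<lambda>x. - u x) z3 z4"
    and mom: "integral {0..L} z = moment L u"
  shows "iter_step L a b c lam p z (dirichlet_inv L (step u))"
proof -
  note s = step[OF u]
  obtain y3 where W: "W41 L (dirichlet_inv L (step u)) (dirichlet_inv1 L (step u)) (\<lambda>x. - step u x) y3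
      (\<lambda>x. p x + rhs u x - M * step u x - N * moment L (step u))"
    and bc: "BC L (dirichlet_inv L (step u)) (\<lambda>x. - step u x)"
    using lin_sol_imp_W41[OF L p_int continuous_rhs[OF u]] s
    unfolding rhs_prim_def[abs_def] by blast
  have "(p x + rhs u x - M * step u x - N * moment L (step u)) - M * (- step u x)
      + N * integral {0..L} (dirichlet_inv L (step u)) =
      p x + b * (- u x) * integral {0..L} z - k1 * (- u x) + k2 * integral {0..L} z" for x
    unfolding integral_dirichlet_inv[OF L lin_sol_continuous[OF s]] mom
    by (simp add: rhs_def algebra_simps)
  then show ?thesis
    unfolding iter_step_def Let_def M_def[symmetric] N_def[symmetric]
      k1_def[symmetric] k2_def[symmetric]
    using W bc z
    by (intro exI conjI) (assumption | simp)+
qed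

lemma dirichlet_inv_step_W41:
  assumes u: "continuous_on {0..L} u"
  shows "\<exists>z3 z4. W41 L (dirichlet_inv L (step u)) (dirichlet_inv1 L (step u)) (\<lambda>x. - step u x) z3 z4"
  using lin_sol_imp_W41[OF L p_int continuous_rhs[OF u]] step[OF u]
  unfolding rhs_prim_def[abs_def] by blast

lemma iteration_exists:
  assumes u: "box u" and W: "W41 L y0 y1 (\<lambda>x. - u x) y3 y4"
    and mom: "integral {0..L} y0 = moment L u"
  shows "\<exists>ys :: nat \<Rightarrow> real \<Rightarrow> real. ys 0 = y0 \<and> (\<forall>n\<ge>1. iter_step L a b c lam p (ys (n - 1)) (ys n))"
proof -
  \<comment> \<open>The start is kept as y0 itself: the required equality is one of functions on the
    whole line, while \<open>dirichlet_inv\<close> reproduces y0 only on [0,L].\<close>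
  define ys where "ys n = (case n of 0 \<Rightarrow> y0 | Suc k \<Rightarrow> dirichlet_inv L ((step ^^ n) u))" for n
  have "iter_step L a b c lam p (ys n) (ys (Suc n))" for n
  proof (cases n)
    case 0
    then show ?thesis using iter_step_exists[OF box_D(1)[OF u] W mom] by (simp add: ys_def)
  next
    case (Suc k)
    note c0 = box_D(1)[OF box_funpow_step[OF u]]
    obtain z3 z4 where "W41 L (dirichlet_inv L ((step ^^ Suc k) u)) (dirichlet_inv1 L ((step ^^ Suc k) u))
        (\<lambda>x. - (step ^^ Suc k) u x) z3 z4"
      using dirichlet_inv_step_W41[OF c0[of k]] by auto
    from iter_step_exists[OF c0 this integral_dirichlet_inv[OF L c0]]
    show ?thesis by (simp add: ys_def Suc)
  qed
  then have "iter_step L a b c lam p (ys (n - 1)) (ys n)" if "n \<ge> 1" for n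
    using that by (cases n) auto
  moreover have "ys 0 = y0" by (simp add: ys_def)
  ultimately show ?thesis by blast
qed

lemma iteration_eq:
  assumes u: "box u" and y0: "\<And>x. x \<in> {0..L} \<Longrightarrow> ys 0 x = dirichlet_inv L u x"
    and it: "\<forall>n\<ge>1. iter_step L a b c lam p (ys (n - 1)) (ys n)" and x: "x \<in> {0..L}"
  shows "ys n x = dirichlet_inv L ((step ^^ n) u) x"
  using x
proof (induction n arbitrary: x)
  case 0
  then show ?case using y0 by simp
next
  case (Suc n)
  have "iter_step L a b c lam p (ys n) (ys (Suc n))" using it[rule_format, of "Suc n"] by simp
  from iter_step_step[OF box_D(1)[OF box_funpow_step[OF u]] Suc.IH this Suc.prems]
  show ?case by simp
qed

lemma iteration_uniform_limit:
  assumes u: "box u" and y0: "\<And>x. x \<in> {0..L} \<Longrightarrow> ys 0 x = dirichlet_inv L u x"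
    and it: "\<forall>n\<ge>1. iter_step L a b c lam p (ys (n - 1)) (ys n)"
    and lim: "uniform_limit {0..L} (\<lambda>n. dirichlet_inv L ((step ^^ n) u)) l sequentially"
  shows "uniform_limit {0..L} ys l sequentially"
proof -
  have "dirichlet_inv L ((step ^^ n) u) x = ys n x" if "x \<in> {0..L}" for n x
    using iteration_eq[OF u y0 it that] by simp
  then show ?thesis
    using lim uniform_limit_cong'[of "{0..L}" "\<lambda>n. dirichlet_inv L ((step ^^ n) u)" ys l l] by blast
qed

section \<open>Monotone convergence and extremality\<close>

text \<open>Monotonicity of \<open>step\<close> propagates the order of the first two iterates to
  all later ones, and the box bounds them. The two alternatives serve the starts 0 and
  \<open>beta_curv\<close>.\<close>

lemma monotone_iteration:
  assumes u: "box u"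
    and "(\<forall>x\<in>{0..L}. u x \<le> step u x) \<or> (\<forall>x\<in>{0..L}. step u x \<le> u x)"
  obtains w where "\<And>x. x \<in> {0..L} \<Longrightarrow> (\<lambda>n. (step ^^ n) u x) \<longlonglongrightarrow> w x"
proof -
  note bx = box_funpow_step[OF u]
  have "convergent (\<lambda>n. (step ^^ n) u x)" if x: "x \<in> {0..L}" for x
  proof (rule Bseq_monoseq_convergent)
    show "Bseq (\<lambda>n. (step ^^ n) u x)"
      by (rule BseqI') (use box_D(4)[OF bx x] in auto)
    from assms(2) show "monoseq (\<lambda>n. (step ^^ n) u x)"
    proof
      assume le: "\<forall>x\<in>{0..L}. u x \<le> step u x"
      have "(step ^^ n) u x \<le> (step ^^ Suc n) u x" if "x \<in> {0..L}" for n x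
        using that
      proof (induction n arbitrary: x)
        case (Suc n)
        have "step ((step ^^ n) u) x \<le> step ((step ^^ Suc n) u) x"
          by (rule step_mono[OF bx bx Suc.IH Suc.prems])
        then show ?case by simp
      qed (use le in auto)
      then show ?thesis using x by (auto simp: monoseq_Suc)
    next
      assume le: "\<forall>x\<in>{0..L}. step u x \<le> u x"
      have "(step ^^ Suc n) u x \<le> (step ^^ n) u x" if "x \<in> {0..L}" for n x
        using that
      proof (induction n arbitrary: x)
        case (Suc n)
        have "step ((step ^^ Suc n) u) x \<le> step ((step ^^ n) u) x"
          by (rule step_mono[OF bx bx Suc.IH Suc.prems])
        then show ?case by simp
      qed (use le in auto)
      then show ?thesis using x by (auto simp: monoseq_Suc)
    qed
  qed
  then show thesis
    by (intro that[of "\<lambda>x. lim (\<lambda>n. (step ^^ n) u x)"]) (simp add: convergent_LIMSEQ_iff)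
qed

text \<open>A fixed point is at once datum and solution of the linear problem, so each comparison
  step reproduces the same v on its side.\<close>

lemma iteration_bounds:
  assumes v: "lin_sol L M N (rhs_prim v) v" "box v" and x: "x \<in> {0..L}"
  shows "(step ^^ n) (\<lambda>x. 0) x \<le> v x" "v x \<le> (step ^^ n) beta_curv x"
proof -
  note b0 = box_funpow_step[OF box_0] and b1 = box_funpow_step[OF box_beta_curv]
  show "(step ^^ n) (\<lambda>x. 0) x \<le> v x" using x
  proof (induction n arbitrary: x)
    case (Suc n)
    show ?case
      using box_comparison[OF b0 v(2) Suc.IH step[OF box_D(1)[OF b0]] v(1) Suc.prems] by simp
  qed (use box_D(2)[OF v(2)] in auto)
  show "v x \<le> (step ^^ n) beta_curv x" using x
  proof (induction n arbitrary: x)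
    case (Suc n)
    show ?case
      using box_comparison[OF v(2) b1 Suc.IH v(1) step[OF box_D(1)[OF b1]] Suc.prems] by simp
  qed (use box_D(3)[OF v(2)] in auto)
qed

end

theorem theorem5p1:
  fixes L a b c lam :: real and p :: "real \<Rightarrow> real"
  assumes L: "L > 0" and a: "a > 0" and b: "b > 0" and c: "c > 0"
    and p_int: "p absolutely_integrable_on {0..L}"
    and p_nonneg: "AE x in lborel. x \<in> {0<..<L} \<longrightarrow> 0 \<le> p x"
    and lam: "lam > 0"
    and hp: "AE x in lborel. x \<in> {0<..<L} \<longrightarrow>
       p x \<le> (lam * pi ^ 4 / L ^ 4 + a * lam * pi ^ 2 / L ^ 2 + 2 * b * lam ^ 2 * pi / L)
                * sin (pi / L * x) + 2 * lam * c * L / pi"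
    and hN: "c + b * lam * pi ^ 2 / L ^ 2
       \<le> 4 * (a + 2 * b * lam * L / pi) / L ^ 3
           * sigma_fn (sqrt (a + 2 * b * lam * L / pi) * L)"
  shows "is_lower_solution L a b c p (\<lambda>x. 0)
    \<and> is_upper_solution L a b c p (\<lambda>x. lam * sin (pi / L * x))
    \<and> (\<exists>ymin ymax.
         is_solution L a b c p ymin \<and> in_S L lam ymin \<and>
         is_solution L a b c p ymax \<and> in_S L lam ymax \<and>
         (\<forall>y. is_solution L a b c p y \<and> in_S L lam y \<longrightarrow>
              (\<forall>x\<in>{0..L}. ymin x \<le> y x \<and> y x \<le> ymax x)) \<and>
         (\<exists>\<alpha>s :: nat \<Rightarrow> real \<Rightarrow> real. \<alpha>s 0 = (\<lambda>x. 0) \<and> (\<forall>n\<ge>1. iter_step L a b c lam p (\<alpha>s (n - 1)) (\<alpha>s n))) \<and>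
         (\<exists>\<beta>s :: nat \<Rightarrow> real \<Rightarrow> real. \<beta>s 0 = (\<lambda>x. lam * sin (pi / L * x)) \<and>
               (\<forall>n\<ge>1. iter_step L a b c lam p (\<beta>s (n - 1)) (\<beta>s n))) \<and>
         (\<forall>\<alpha>s :: nat \<Rightarrow> real \<Rightarrow> real. \<alpha>s 0 = (\<lambda>x. 0) \<and>
              (\<forall>n\<ge>1. iter_step L a b c lam p (\<alpha>s (n - 1)) (\<alpha>s n)) \<longrightarrow>
              uniform_limit {0..L} \<alpha>s ymin sequentially) \<and>
         (\<forall>\<beta>s :: nat \<Rightarrow> real \<Rightarrow> real. \<beta>s 0 = (\<lambda>x. lam * sin (pi / L * x)) \<and>
              (\<forall>n\<ge>1. iter_step L a b c lam p (\<beta>s (n - 1)) (\<beta>s n)) \<longrightarrow>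
              uniform_limit {0..L} \<beta>s ymax sequentially))"
proof -
  interpret plate_problem L a b c lam p
    by (rule plate_problem.intro[OF assms])
  have beta: "(\<lambda>x. lam * sin (pi / L * x)) = beta" by (simp add: beta_def fun_eq_iff)
  obtain v where vlim: "\<And>x. x \<in> {0..L} \<Longrightarrow> (\<lambda>n. (step ^^ n) (\<lambda>x. 0) x) \<longlonglongrightarrow> v x"
    using monotone_iteration[OF box_0] step_0_nonneg by blast
  obtain w where wlim: "\<And>x. x \<in> {0..L} \<Longrightarrow> (\<lambda>n. (step ^^ n) beta_curv x) \<longlonglongrightarrow> w x"
    using monotone_iteration[OF box_beta_curv] step_beta_curv_le by blast
  note v = step_limit[OF box_funpow_step[OF box_0] _ vlim, simplified]
  note w = step_limit[OF box_funpow_step[OF box_beta_curv] _ wlim, simplified]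
  have zero: "dirichlet_inv L (\<lambda>x. 0) x = 0" for x by (simp add: dirichlet_inv_def)
  have extremal: "dirichlet_inv L v x \<le> y x \<and> y x \<le> dirichlet_inv L w x"
    if y_sol: "is_solution L a b c p y" and y_S: "in_S L lam y" and x: "x \<in> {0..L}" for y x
  proof -
    obtain z where z: "lin_sol L M N (rhs_prim z) z" and y: "\<And>x. x \<in> {0..L} \<Longrightarrow> y x = dirichlet_inv L z x"
      using solution_imp_fixed[OF y_sol] by blast
    note cz = lin_sol_continuous[OF z]
    have bz: "box z" using in_S_imp_box[OF y_S cz y] .
    \<comment> \<open>Extremality is obtained for the negative second derivatives and carried over
      to the functions by the monotone Green operator.\<close>
    have "v s \<le> z s" "z s \<le> w s" if s: "s \<in> {0..L}" for s
      using iteration_bounds[OF z bz s] vlim[OF s] wlim[OF s]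
      by (auto intro: LIMSEQ_le_const LIMSEQ_le_const2)
    then show ?thesis
      unfolding y[OF x] using box_D(1) v(2) w(2) cz
      by (auto intro!: dirichlet_inv_mono[OF L _ _ _ x])
  qed
  show ?thesis
    unfolding beta
  proof (intro conjI, rule lower_solution, rule upper_solution,
      rule exI[of _ "dirichlet_inv L v"], rule exI[of _ "dirichlet_inv L w"], intro conjI allI impI ballI)
    show "is_solution L a b c p (dirichlet_inv L v)" "in_S L lam (dirichlet_inv L v)"
      "is_solution L a b c p (dirichlet_inv L w)" "in_S L lam (dirichlet_inv L w)"
      by (rule fixed_imp_solution[OF v(1)] box_imp_in_S[OF v(2)]
          fixed_imp_solution[OF w(1)] box_imp_in_S[OF w(2)])+
    show "dirichlet_inv L v x \<le> y x" "y x \<le> dirichlet_inv L w x"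
      if "is_solution L a b c p y \<and> in_S L lam y" "x \<in> {0..L}" for y x
      using extremal that by blast+
    show "\<exists>\<alpha>s :: nat \<Rightarrow> real \<Rightarrow> real. \<alpha>s 0 = (\<lambda>x. 0) \<and> (\<forall>n\<ge>1. iter_step L a b c lam p (\<alpha>s (n - 1)) (\<alpha>s n))"
      by (rule iteration_exists[OF box_0, of _ "\<lambda>x. 0" "\<lambda>x. 0" "\<lambda>x. 0"])
         (auto simp: W41_def moment_def)
    show "\<exists>\<beta>s :: nat \<Rightarrow> real \<Rightarrow> real. \<beta>s 0 = beta \<and> (\<forall>n\<ge>1. iter_step L a b c lam p (\<beta>s (n - 1)) (\<beta>s n))"
      by (rule iteration_exists[OF box_beta_curv W41_beta integral_beta_moment])
    show "uniform_limit {0..L} \<alpha>s (dirichlet_inv L v) sequentially"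
      if "\<alpha>s 0 = (\<lambda>x. 0) \<and> (\<forall>n\<ge>1. iter_step L a b c lam p (\<alpha>s (n - 1)) (\<alpha>s n))" for \<alpha>s
      using that by (intro iteration_uniform_limit[OF box_0 _ _ v(3)]) (simp_all add: zero)
    show "uniform_limit {0..L} \<beta>s (dirichlet_inv L w) sequentially"
      if "\<beta>s 0 = beta \<and> (\<forall>n\<ge>1. iter_step L a b c lam p (\<beta>s (n - 1)) (\<beta>s n))" for \<beta>s
      using that by (intro iteration_uniform_limit[OF box_beta_curv _ _ w(3)])
        (simp_all add: beta_eq)
  qed
qed

end
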